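(* Let $\alpha_i\in(0,2)$ for $i=1,\dots,N$ with $\sum_{i=1}^N\frac1{\alpha_i}>1$, and let $$-\mathfrak{L}=-\mathcal{L}^\mu=\sum_{i=1}^N(-\partial_{x_ix_i}^2)^{\frac{\alpha_i}2}.$$ Then $$\|\mathbb{G}_{I-\mathcal{L}^\mu}^{x_0}\|_{L^p(\mathbb{R}^N)}=\|\mathbb{G}_{I-\mathcal{L}^\mu}^{0}\|_{L^p(\mathbb{R}^N)}\le C_p<\infty$$ for some $$p\in\Bigg(1,\frac{\sum_{i=1}^N\frac1{\alpha_i}}{\sum_{i=1}^N\frac1{\alpha_i}-1}\Bigg).$$
   Context: Throughout $N\ge3$. The operator is the sum of one-dimensional fractional Laplacians in the coordinate directions; it is $-\mathcal{L}^\mu$, with $\mathcal{L}^\mu[\psi](x)=P.V.\int_{\mathbb{R}^N\setminus\{0\}}(\psi(x+z)-\psi(x))d\mu(z)$ and $d\mu(z)=C\sum_{i=1}^N|z_i|^{-(1+\alpha_i)}dz_i\prod_{j\ne i}d\delta_0(z_j)$ for a normalizing constant $C>0$. $\mathbb{H}_{-\mathcal{L}^\mu}^{x_0}(x,t)=\mathbb{H}_{-\mathcal{L}^\mu}^{0}(x-x_0,t)$ is the heat kernel, i.e. the kernel of the solution semigroup of $\partial_tu+(-\mathcal{L}^\mu)[u]=0$, and $\mathbb{G}_{I-\mathcal{L}^\mu}^{x_0}(x)=\int_0^\infty e^{-t}\mathbb{H}_{-\mathcal{L}^\mu}^{x_0}(x,t)\,dt$ is the Green function of $I-\mathcal{L}^\mu$.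 *)

theory Defs
  imports "HOL-Analysis.Analysis"
begin

text \<open>
  The measure \<open>\<Sum>i. C i |z\<^sub>i| powr -(1 + \<alpha> i) dz\<^sub>i \<Prod>j\<noteq>i. d\<delta>\<^sub>0(z\<^sub>j)\<close>, obtained by pushing
  the measure with density \<open>C i |r| powr -(1 + \<alpha> i)\<close> on the \<open>i\<close>-th copy of the real line forward
  along \<open>r \<mapsto> r e\<^sub>i\<close>; see \<open>emeasure_axis_levy_measure\<close> below. The origin is a null set,
  since \<open>0 powr a = 0\<close>. The constants may differ between directions because the constant that
  normalises the one-dimensional fractional Laplacian of order \<open>\<alpha> i\<close> depends on \<open>\<alpha> i\<close>.
\<close>

definition axis_levy_measure :: "('n::finite \<Rightarrow> real) \<Rightarrow> ('n \<Rightarrow> real) \<Rightarrow> (real ^ 'n) measure" where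
  "axis_levy_measure \<alpha> C =
     distr
       (density (count_space UNIV \<Otimes>\<^sub>M lborel)
          (\<lambda>(i, r). ennreal (C i * \<bar>r\<bar> powr - (1 + \<alpha> i))))
       borel (\<lambda>(i, r). axis i r)"

lemma measurable_axis_pair:
  "(\<lambda>(i, r). axis i r :: real ^ 'n) \<in> borel_measurable (count_space (UNIV :: 'n::finite set) \<Otimes>\<^sub>M lborel)"
proof -
  have "(\<lambda>r. axis i r :: real ^ 'n) \<in> borel_measurable lborel" for i :: 'n
  proof -
    have "continuous_on UNIV (\<lambda>r. axis i r :: real ^ 'n)"
    proof -
      have "continuous_on UNIV (\<lambda>r. if j = i then r else (0::real))" for j
        by (cases "j = i") auto
      then show ?thesis
        unfolding axis_def by (intro continuous_on_vec_lambda)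
    qed
    then show ?thesis
      by (simp add: borel_measurable_continuous_onI)
  qed
  then show ?thesis
    by (intro measurable_pair_measure_countable1) auto
qed

lemma emeasure_axis_levy_measure:
  fixes A :: "(real ^ 'n::finite) set"
  assumes "A \<in> sets borel"
  shows "emeasure (axis_levy_measure \<alpha> C) A =
    (\<Sum>i\<in>UNIV. \<integral>\<^sup>+ r. ennreal (C i * \<bar>r\<bar> powr - (1 + \<alpha> i)) * indicator A (axis i r) \<partial>lborel)"
proof -
  have [measurable]: "(\<lambda>(i, r). ennreal (C i * \<bar>r\<bar> powr - (1 + \<alpha> i))) \<in> borel_measurable (count_space (UNIV::'n set) \<Otimes>\<^sub>M lborel)"
    by (intro measurable_pair_measure_countable1) auto
  note measurable_axis_pair[measurable] assms[measurable]
  let ?M = "count_space (UNIV::'n set) \<Otimes>\<^sub>M lborel"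
  have "emeasure (axis_levy_measure \<alpha> C) A =
    (\<integral>\<^sup>+ p. (case p of (i, r) \<Rightarrow> ennreal (C i * \<bar>r\<bar> powr - (1 + \<alpha> i)) * indicator A (axis i r)) \<partial>?M)"
    unfolding axis_levy_measure_def
    apply (subst emeasure_distr)
      apply simp
     apply (rule assms)
    apply (subst emeasure_density)
      apply (simp_all)
    apply (rule nn_integral_cong)
    apply (auto split: split_indicator simp: space_pair_measure)
    done
  also have "\<dots> = (\<integral>\<^sup>+ i. \<integral>\<^sup>+ r. ennreal (C i * \<bar>r\<bar> powr - (1 + \<alpha> i)) * indicator A (axis i r) \<partial>lborel \<partial>count_space UNIV)"
    by (subst lborel.nn_integral_fst[symmetric]) (auto simp: case_prod_beta)
  also have "\<dots> = (\<Sum>i\<in>UNIV. \<integral>\<^sup>+ r. ennreal (C i * \<bar>r\<bar> powr - (1 + \<alpha> i)) * indicator A (axis i r) \<partial>lborel)"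
    by (rule nn_integral_count_space_finite) simp
  finally show ?thesis .
qed

text \<open>
  \<open>has_levy_value \<mu> \<psi> x l\<close>: the principal value
  \<open>P.V. \<integral>\<^bsub>z \<noteq> 0\<^esub> (\<psi>(x + z) - \<psi>(x)) d\<mu>(z)\<close> exists and equals \<open>l\<close>.
\<close>

definition has_levy_value ::
    "(real ^ 'n::finite) measure \<Rightarrow> (real ^ 'n \<Rightarrow> real) \<Rightarrow> real ^ 'n \<Rightarrow> real \<Rightarrow> bool" where
  "has_levy_value \<mu> \<psi> x l \<longleftrightarrow>
     (\<forall>\<epsilon>>0. set_integrable \<mu> {z. \<epsilon> < norm z} (\<lambda>z. \<psi> (x + z) - \<psi> x)) \<and>
     ((\<lambda>\<epsilon>. LINT z:{z. \<epsilon> < norm z}|\<mu>. \<psi> (x + z) - \<psi> x) \<longlongrightarrow> l) (at_right 0)"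

definition C2_compact_support :: "(real ^ 'n::finite \<Rightarrow> real) \<Rightarrow> bool" where
  "C2_compact_support \<phi> \<longleftrightarrow>
     compact (closure {x. \<phi> x \<noteq> 0}) \<and>
     (\<exists>D :: real ^ 'n \<Rightarrow> (real ^ 'n) \<Rightarrow>\<^sub>L real. \<exists>D2 :: real ^ 'n \<Rightarrow> (real ^ 'n) \<Rightarrow>\<^sub>L ((real ^ 'n) \<Rightarrow>\<^sub>L real).
        (\<forall>x. (\<phi> has_derivative blinfun_apply (D x)) (at x)) \<and>
        (\<forall>x. (D has_derivative blinfun_apply (D2 x)) (at x)) \<and>
        continuous_on UNIV D2)"

text \<open>
  \<open>u\<close> is a classical solution of \<open>\<partial>\<^sub>t u = L\<^sup>\<mu>[u]\<close> on \<open>\<real>\<^sup>N \<times> (0, \<infinity>)\<close> with initial datum \<open>\<phi>\<close>.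
\<close>

definition solves_heat_equation ::
    "(real ^ 'n::finite) measure \<Rightarrow> (real ^ 'n \<Rightarrow> real) \<Rightarrow> (real ^ 'n \<Rightarrow> real \<Rightarrow> real) \<Rightarrow> bool" where
  "solves_heat_equation \<mu> \<phi> u \<longleftrightarrow>
     (\<forall>x. \<forall>t>0. \<exists>l. (u x has_real_derivative l) (at t) \<and> has_levy_value \<mu> (\<lambda>y. u y t) x l) \<and>
     (\<forall>x. (u x \<longlongrightarrow> \<phi> x) (at_right 0))"

definition heat_semigroup ::
    "(real ^ 'n::finite \<Rightarrow> real \<Rightarrow> real) \<Rightarrow> (real ^ 'n \<Rightarrow> real) \<Rightarrow> real ^ 'n \<Rightarrow> real \<Rightarrow> real" where
  "heat_semigroup H \<phi> x t = (LINT y|lborel. H (x - y) t * \<phi> y)"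

text \<open>
  \<open>H\<close> is the heat kernel \<open>H\<^sup>0(x, t)\<close> with pole at the origin: the convolution operators with
  \<open>H\<^sup>0(\<cdot>, t)\<close>, \<open>t > 0\<close>, form the (positive, contractive) solution semigroup of
  \<open>\<partial>\<^sub>t u - L\<^sup>\<mu>[u] = 0\<close>. As a kernel, \<open>H\<^sup>0(\<cdot>, t)\<close> is determined only up to null sets, so the
  semigroup law is required almost everywhere; the values at \<open>t \<le> 0\<close> are irrelevant.
\<close>

definition is_heat_kernel ::
    "(real ^ 'n::finite) measure \<Rightarrow> (real ^ 'n \<Rightarrow> real \<Rightarrow> real) \<Rightarrow> bool" where
  "is_heat_kernel \<mu> H \<longleftrightarrow>
     set_borel_measurable borel (UNIV \<times> {0<..}) (\<lambda>(x, t). H x t) \<and>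
     (\<forall>t>0. (\<forall>x. 0 \<le> H x t) \<and> integrable lborel (\<lambda>x. H x t) \<and> (LINT x|lborel. H x t) \<le> 1) \<and>
     (\<forall>s>0. \<forall>t>0. AE x in lborel. heat_semigroup H (\<lambda>y. H y s) x t = H x (s + t)) \<and>
     (\<forall>\<phi>. C2_compact_support \<phi> \<longrightarrow> solves_heat_equation \<mu> \<phi> (heat_semigroup H \<phi>))"

text \<open>
  The Green function of \<open>I - L\<^sup>\<mu>\<close> with pole \<open>x0\<close>; the heat kernel with pole \<open>x0\<close> is
  \<open>H\<^sup>0(x - x0, t)\<close>. The value may be infinite at some points, e.g. at \<open>x = x0\<close>.
\<close>

definition resolvent_green ::
    "(real ^ 'n::finite \<Rightarrow> real \<Rightarrow> real) \<Rightarrow> real ^ 'n \<Rightarrow> real ^ 'n \<Rightarrow> ennreal" where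
  "resolvent_green H x0 x = (\<integral>\<^sup>+ t\<in>{0<..}. ennreal (exp (- t) * H (x - x0) t) \<partial>lborel)"

text \<open>Powers of extended nonnegative reals, for exponents \<open>p > 0\<close>.\<close>

definition ennreal_powr :: "ennreal \<Rightarrow> real \<Rightarrow> ennreal" where
  "ennreal_powr a p = (if a = top then top else ennreal (enn2real a powr p))"

definition Lp_norm :: "real \<Rightarrow> (real ^ 'n::finite \<Rightarrow> ennreal) \<Rightarrow> ennreal" where
  "Lp_norm p f = ennreal_powr (\<integral>\<^sup>+ x. ennreal_powr (f x) p \<partial>lborel) (1 / p)"

end

theory Submission
  imports Defs "HOL-Probability.Probability"
begin

text \<open>
  Write \<open>S = (\<Sum>i. 1 / \<alpha> i)\<close>. The proof rests on the bound \<open>H(\<cdot>, t) \<le> const * t powr - S\<close> almost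
  everywhere. Since \<open>H(\<cdot>, t)\<close> has mass at most \<open>1\<close>, it gives
  \<open>\<integral> H(\<cdot>, t) powr p \<le> const * t powr - (S * (p - 1))\<close>, and Jensen's inequality for the probability
  density \<open>exp (- t)\<close> (\<open>exp_weighted_jensen\<close>) bounds the \<open>p\<close>-th power of the \<open>L\<^sup>p\<close> norm of the Green
  function by the time integral of this against \<open>exp (- t)\<close>. That integral is finite once
  \<open>S * (p - 1) < 1\<close>, a condition that also implies \<open>p < S / (S - 1)\<close>. The norm does not depend on the
  pole by translation invariance of Lebesgue measure.

  The pointwise bound has to be extracted from the description of \<open>H\<close> as a semigroup of classical
  solutions, with no formula for \<open>H\<close> available. For fixed \<open>x\<close> put
  \<open>f(t) = \<integral> H(y, t) cos (\<xi> \<bullet> (x - y)) dy\<close>. Plane waves are eigenfunctions of \<open>L\<^sup>\<mu>\<close> with eigenvalue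
  \<open>- m(\<xi>)\<close>, where \<open>m\<close> is the \<open>levy_symbol\<close>, so formally \<open>f' = - m(\<xi>) f\<close> and, as \<open>\<bar>f\<bar> \<le> 1\<close>,
  \<open>\<bar>f(t)\<bar> \<le> exp (- t m(\<xi>))\<close>. Plane waves are not compactly supported; they are replaced by
  \<open>C\<^sup>2\<close> truncations whose second differences are bounded uniformly in the truncation radius, and the
  argument is carried out in the limit (\<open>heat_kernel_fourier_decay\<close>).

  No Fourier inversion is needed. A Gaussian of width \<open>d\<close> is an average of plane waves, so the decay
  in \<open>\<xi>\<close> together with \<open>m(\<xi>) \<ge> (\<Sum>i. c i * \<bar>\<xi> $ i\<bar> powr \<alpha> i)\<close> bounds the Gaussian averages of
  \<open>H(\<cdot>, t)\<close> at every scale \<open>d\<close> by \<open>const * t powr - S * d ^ N\<close> (\<open>heat_kernel_gaussian_average\<close>).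
  Letting \<open>d\<close> tend to \<open>0\<close> turns this into the almost everywhere bound
  (\<open>AE_le_of_gaussian_averages\<close>).
\<close>


section \<open>Compactly supported approximations of plane waves\<close>

lemma second_difference_bound:
  fixes \<phi> :: "'a::real_normed_vector \<Rightarrow> real"
  assumes D: "\<And>x. (\<phi> has_derivative blinfun_apply (D x)) (at x)"
    and D2: "\<And>x. (D has_derivative blinfun_apply (D2 x)) (at x)"
    and M: "\<And>x. norm (D2 x) \<le> M"
  shows "\<bar>\<phi> (w + v) + \<phi> (w - v) - 2 * \<phi> w\<bar> \<le> 2 * M * (norm v)\<^sup>2"
proof -
  have M0: "0 \<le> M" using M[of 0] norm_ge_zero order_trans by blast
  have lip: "norm (D x - D y) \<le> M * norm (x - y)" for x y
    by (rule differentiable_bound[of UNIV D "\<lambda>x. blinfun_apply (D2 x)"])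
       (use D2 M in \<open>auto simp: norm_blinfun.rep_eq[symmetric] intro: has_derivative_at_withinI\<close>)
  define k where "k r = \<phi> (w + r *\<^sub>R v) + \<phi> (w - r *\<^sub>R v)" for r
  have k': "(k has_derivative (\<lambda>h. h *\<^sub>R (D (w + r *\<^sub>R v) v - D (w - r *\<^sub>R v) v))) (at r)" for r
  proof -
    have "((\<lambda>r. \<phi> (w + r *\<^sub>R v)) has_derivative (\<lambda>h. D (w + r *\<^sub>R v) (h *\<^sub>R v))) (at r)"
      by (rule has_derivative_compose[OF _ D]) (auto intro!: derivative_eq_intros)
    moreover have "((\<lambda>r. \<phi> (w - r *\<^sub>R v)) has_derivative (\<lambda>h. D (w - r *\<^sub>R v) (- (h *\<^sub>R v)))) (at r)"
      by (rule has_derivative_compose[OF _ D]) (auto intro!: derivative_eq_intros)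
    ultimately show ?thesis unfolding k_def
      by (rule has_derivative_eq_rhs[OF has_derivative_add])
         (auto simp: fun_eq_iff blinfun.scaleR_right blinfun.minus_right algebra_simps)
  qed
  have "norm (k 1 - k 0) \<le> (2 * M * (norm v)\<^sup>2) * norm (1 - 0 :: real)"
  proof (rule differentiable_bound[of "{0..1}" k "\<lambda>r h. h *\<^sub>R (D (w + r *\<^sub>R v) v - D (w - r *\<^sub>R v) v)"])
    fix r :: real assume r: "r \<in> {0..1}"
    have "norm (h *\<^sub>R (D (w + r *\<^sub>R v) v - D (w - r *\<^sub>R v) v)) \<le> (2 * M * (norm v)\<^sup>2) * norm h" for h
    proof -
      have "norm (D (w + r *\<^sub>R v) v - D (w - r *\<^sub>R v) v)
          \<le> norm (D (w + r *\<^sub>R v) - D (w - r *\<^sub>R v)) * norm v"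
        using norm_blinfun[of "D (w + r *\<^sub>R v) - D (w - r *\<^sub>R v)" v] by (simp add: blinfun.diff_left)
      also have "\<dots> \<le> (M * norm ((w + r *\<^sub>R v) - (w - r *\<^sub>R v))) * norm v"
        by (intro mult_right_mono lip) auto
      also have "(w + r *\<^sub>R v) - (w - r *\<^sub>R v) = (2 * r) *\<^sub>R v"
        by (simp add: algebra_simps flip: scaleR_2)
      also have "(M * norm ((2 * r) *\<^sub>R v)) * norm v = r * (2 * M * (norm v)\<^sup>2)"
        using r by (simp add: power2_eq_square)
      also have "\<dots> \<le> 1 * (2 * M * (norm v)\<^sup>2)"
        by (rule mult_right_mono) (use r M0 in auto)
      finally have "\<bar>h\<bar> * norm (D (w + r *\<^sub>R v) v - D (w - r *\<^sub>R v) v) \<le> \<bar>h\<bar> * (1 * (2 * M * (norm v)\<^sup>2))"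
        by (rule mult_left_mono) simp
      then show ?thesis by (simp add: abs_mult mult.commute)
    qed
    then show "onorm (\<lambda>h. h *\<^sub>R (D (w + r *\<^sub>R v) v - D (w - r *\<^sub>R v) v)) \<le> 2 * M * (norm v)\<^sup>2"
      by (rule onorm_bound[rotated]) (use M0 in auto)
  qed (use k' in \<open>auto intro: has_derivative_at_withinI\<close>)
  then show ?thesis by (simp add: k_def)
qed

text \<open>Truncated powers; \<open>hinge_power 3\<close> is a \<open>C\<^sup>2\<close> cutoff vanishing on \<open>[1, \<infinity>)\<close>.\<close>

definition hinge_power :: "nat \<Rightarrow> real \<Rightarrow> real" where
  "hinge_power k s = max 0 (1 - s) ^ k"

lemma hinge_power_nonneg: "0 \<le> hinge_power k s"
  by (simp add: hinge_power_def)

lemma hinge_power_le_1: "0 \<le> s \<Longrightarrow> hinge_power k s \<le> 1"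
  by (auto simp: hinge_power_def intro!: power_le_one)

lemma hinge_power_eq_0: "1 \<le> s \<Longrightarrow> 0 < k \<Longrightarrow> hinge_power k s = 0"
  by (simp add: hinge_power_def)

lemma continuous_hinge_power [continuous_intros]:
  "continuous_on S f \<Longrightarrow> continuous_on S (\<lambda>x. hinge_power k (f x))"
  unfolding hinge_power_def by (intro continuous_intros)

lemma DERIV_hinge_power:
  assumes "2 \<le> k"
  shows "(hinge_power k has_real_derivative - (real k * hinge_power (k - 1) s)) (at s)"
proof -
  consider "s < 1" | "s > 1" | "s = 1" by linarith
  then show ?thesis
  proof cases
    case 1
    have "max 0 (1 - s) = 1 - s" using 1 by simp
    then have "((\<lambda>s. (1 - s) ^ k) has_real_derivative - (real k * hinge_power (k - 1) s)) (at s)"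
      by (auto intro!: derivative_eq_intros simp: hinge_power_def)
    then show ?thesis
      by (rule has_field_derivative_transform_within_open[where S = "{..<1}"])
         (use 1 in \<open>auto simp: hinge_power_def max_def\<close>)
  next
    case 2
    have "((\<lambda>s. 0) has_real_derivative - (real k * hinge_power (k - 1) s)) (at s)"
      using 2 assms by (simp add: hinge_power_eq_0)
    then show ?thesis
      by (rule has_field_derivative_transform_within_open[where S = "{1<..}"])
         (use 2 assms in \<open>auto simp: hinge_power_def max_def\<close>)
  next
    case 3
    have "((\<lambda>h. hinge_power k (1 + h) / h) \<longlongrightarrow> 0) (at 0)"
    proof (rule Lim_null_comparison)
      show "\<forall>\<^sub>F h in at 0. norm (hinge_power k (1 + h) / h) \<le> \<bar>h\<bar> ^ (k - 1)"
      proof (intro always_eventually allI)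
        fix h :: real
        have "max 0 (- h) ^ k \<le> \<bar>h\<bar> ^ k" by (intro power_mono) auto
        also have "\<dots> = \<bar>h\<bar> * \<bar>h\<bar> ^ (k - 1)" using assms by (simp flip: power_Suc)
        finally show "norm (hinge_power k (1 + h) / h) \<le> \<bar>h\<bar> ^ (k - 1)"
          by (cases "h = 0") (auto simp: hinge_power_def divide_le_eq mult.commute)
      qed
      have "((\<lambda>h::real. \<bar>h\<bar> ^ (k - 1)) \<longlongrightarrow> \<bar>0\<bar> ^ (k - 1)) (at 0)"
        by (intro tendsto_intros)
      then show "((\<lambda>h::real. \<bar>h\<bar> ^ (k - 1)) \<longlongrightarrow> 0) (at 0)"
        using assms by (simp add: power_0_left)
    qed
    then show ?thesis
      using 3 assms by (simp add: DERIV_def hinge_power_def power_0_left)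
  qed
qed

text \<open>A plane wave cut off at distance \<open>R\<close> from the origin.\<close>

definition wave_packet :: "'a::real_inner \<Rightarrow> real \<Rightarrow> 'a \<Rightarrow> real" where
  "wave_packet \<xi> R x = hinge_power 3 (x \<bullet> x / R\<^sup>2) * cos (\<xi> \<bullet> x)"

lemma abs_wave_packet_le: "\<bar>wave_packet \<xi> R x\<bar> \<le> 1"
proof -
  have "\<bar>hinge_power 3 (x \<bullet> x / R\<^sup>2)\<bar> * \<bar>cos (\<xi> \<bullet> x)\<bar> \<le> 1 * 1"
    by (intro mult_mono) (auto simp: abs_of_nonneg hinge_power_nonneg hinge_power_le_1)
  then show ?thesis by (simp add: wave_packet_def abs_mult)
qed

lemma continuous_wave_packet: "continuous_on UNIV (wave_packet \<xi> R)"
proof -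
  have "continuous_on UNIV (\<lambda>x. hinge_power 3 (x \<bullet> x * inverse (R\<^sup>2)) * cos (\<xi> \<bullet> x))"
    by (intro continuous_intros)
  then show ?thesis by (simp add: wave_packet_def[abs_def] divide_inverse)
qed

lemma tendsto_wave_packet:
  "(\<lambda>n. wave_packet \<xi> (real (Suc n)) x) \<longlonglongrightarrow> cos (\<xi> \<bullet> x)"
proof -
  have "(\<lambda>n. x \<bullet> x * (inverse (real (Suc n)))\<^sup>2) \<longlonglongrightarrow> x \<bullet> x * 0\<^sup>2"
    by (intro tendsto_intros LIMSEQ_inverse_real_of_nat)
  then have "(\<lambda>n. x \<bullet> x / (real (Suc n))\<^sup>2) \<longlonglongrightarrow> 0"
    by (simp add: divide_inverse power_inverse)
  moreover have "isCont (hinge_power 3) 0"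
    using continuous_hinge_power[of UNIV id 3] by (simp add: continuous_on_eq_continuous_at)
  ultimately have "(\<lambda>n. hinge_power 3 (x \<bullet> x / (real (Suc n))\<^sup>2)) \<longlonglongrightarrow> hinge_power 3 0"
    by (rule isCont_tendsto_compose[rotated])
  then show ?thesis
    unfolding wave_packet_def using tendsto_mult_right[of _ "hinge_power 3 0" sequentially "cos (\<xi> \<bullet> x)"]
    by (simp add: hinge_power_def)
qed

text \<open>
  For fixed \<open>\<xi>\<close> the second derivatives are bounded uniformly in \<open>R \<ge> 1\<close>; the limit \<open>R \<rightarrow> \<infinity>\<close>
  in the heat equation rests on this uniformity.
\<close>

lemma wave_packet_derivatives:
  fixes \<xi> :: "'a::euclidean_space"
  assumes R: "1 \<le> R"
  obtains D :: "'a \<Rightarrow> 'a \<Rightarrow>\<^sub>L real" and D2 :: "'a \<Rightarrow> 'a \<Rightarrow>\<^sub>L 'a \<Rightarrow>\<^sub>L real"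
  where "\<And>x. (wave_packet \<xi> R has_derivative blinfun_apply (D x)) (at x)"
    and "\<And>x. (D has_derivative blinfun_apply (D2 x)) (at x)"
    and "continuous_on UNIV D2"
    and "\<And>x. norm (D2 x) \<le> 30 + 12 * norm \<xi> + (norm \<xi>)\<^sup>2"
proof -
  define c where "c = 1 / R\<^sup>2"
  have c: "0 < c" "c \<le> 1" "c * (R * R) = 1"
    using R by (auto simp: c_def power2_eq_square one_le_power mult_ge1_I)
  define s where "s x = c * (x \<bullet> x)" for x :: 'a
  define J where "J = (blinfun_inner_right \<xi> :: 'a \<Rightarrow>\<^sub>L real)"
  define I where "I = (blinfun_inner_right :: 'a \<Rightarrow> 'a \<Rightarrow>\<^sub>L real)"
  define II where "II = Blinfun I"
  have II: "blinfun_apply II h = I h" for h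
    unfolding II_def I_def by (simp add: bounded_linear_Blinfun_apply bounded_linear_blinfun_inner_right)
  have IJ: "blinfun_apply (I x) h = x \<bullet> h" "blinfun_apply J h = \<xi> \<bullet> h" for x h
    by (simp_all add: I_def J_def)
  define G where "G k x = hinge_power k (s x)" for k :: nat and x :: 'a
  define A where "A x = - 6 * c * G 2 x * cos (\<xi> \<bullet> x)" for x
  define B where "B x = G 3 x * sin (\<xi> \<bullet> x)" for x
  define D where "D x = A x *\<^sub>R I x - B x *\<^sub>R J" for x
  \<comment> \<open>The rank one operators \<open>h \<mapsto> p h *\<^sub>R q\<close>.\<close>
  define T where "T p q = blinfun_scaleR_left q o\<^sub>L p" for p q :: "'a \<Rightarrow>\<^sub>L real"
  have T: "blinfun_apply (T p q) h = p h *\<^sub>R q" for p q h by (simp add: T_def)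
  define D2 where "D2 x = (24 * c * c * G 1 x * cos (\<xi> \<bullet> x)) *\<^sub>R T (I x) (I x)
     + (6 * c * G 2 x * sin (\<xi> \<bullet> x)) *\<^sub>R T J (I x)
     + A x *\<^sub>R II + (6 * c * G 2 x * sin (\<xi> \<bullet> x)) *\<^sub>R T (I x) J - (G 3 x * cos (\<xi> \<bullet> x)) *\<^sub>R T J J" for x
  have s: "(s has_derivative (\<lambda>h. 2 * c * (x \<bullet> h))) (at x)" for x
    unfolding s_def by (auto intro!: derivative_eq_intros simp: inner_commute fun_eq_iff algebra_simps)
  have G: "(G k has_derivative (\<lambda>h. - (real k * G (k - 1) x) * (2 * c * (x \<bullet> h)))) (at x)" if "2 \<le> k" for k x
    unfolding G_def
    using has_derivative_compose[OF s DERIV_hinge_power[OF that, of "s x", unfolded has_field_derivative_def]]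
    by simp
  have co: "((\<lambda>x. cos (\<xi> \<bullet> x)) has_derivative (\<lambda>h. - sin (\<xi> \<bullet> x) * (\<xi> \<bullet> h))) (at x)"
    and si: "((\<lambda>x. sin (\<xi> \<bullet> x)) has_derivative (\<lambda>h. cos (\<xi> \<bullet> x) * (\<xi> \<bullet> h))) (at x)" for x
    by (auto intro!: derivative_eq_intros simp: fun_eq_iff)
  have wp: "wave_packet \<xi> R = (\<lambda>x. G 3 x * cos (\<xi> \<bullet> x))"
    by (simp add: fun_eq_iff wave_packet_def G_def s_def c_def)
  have 1: "(wave_packet \<xi> R has_derivative blinfun_apply (D x)) (at x)" for x
    unfolding wp
    by (rule has_derivative_eq_rhs[OF has_derivative_mult[OF G co]])
       (auto simp: fun_eq_iff D_def IJ A_def B_def blinfun.bilinear_simps algebra_simps)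
  have A: "(A has_derivative (\<lambda>h. 24 * c * c * G 1 x * cos (\<xi> \<bullet> x) * (x \<bullet> h)
              + 6 * c * G 2 x * sin (\<xi> \<bullet> x) * (\<xi> \<bullet> h))) (at x)" for x
    unfolding A_def mult.assoc
    by (rule has_derivative_eq_rhs[OF has_derivative_mult_right[OF has_derivative_mult_right[OF has_derivative_mult[OF G co]]]])
       (auto simp: fun_eq_iff algebra_simps)
  have B: "(B has_derivative (\<lambda>h. - 6 * c * G 2 x * sin (\<xi> \<bullet> x) * (x \<bullet> h)
              + G 3 x * cos (\<xi> \<bullet> x) * (\<xi> \<bullet> h))) (at x)" for x
    unfolding B_def
    by (rule has_derivative_eq_rhs[OF has_derivative_mult[OF G si]])
       (auto simp: fun_eq_iff algebra_simps)
  have I': "(I has_derivative I) (at x)" for x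
    unfolding I_def by (rule bounded_linear_imp_has_derivative[OF bounded_linear_blinfun_inner_right])
  have 2: "(D has_derivative blinfun_apply (D2 x)) (at x)" for x
    unfolding D_def
    apply (rule has_derivative_eq_rhs[OF has_derivative_diff[OF has_derivative_scaleR[OF A I'] has_derivative_scaleR_left[OF B]]])
    apply (rule ext)
    apply (simp add: D2_def blinfun.bilinear_simps T II IJ A_def)
    apply (simp add: algebra_simps)
    done
  have Gc: "continuous_on UNIV (G k)" for k
    unfolding G_def s_def by (intro continuous_intros)
  have 3: "continuous_on UNIV D2"
    unfolding D2_def T_def A_def I_def
    by (intro continuous_intros Gc linear_continuous_on bounded_linear_blinfun_inner_right
      bounded_linear_blinfun_scaleR_left
      bounded_linear.continuous_on[OF bounded_linear_blinfun_scaleR_left])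
  have G01: "0 \<le> G k x" "G k x \<le> 1" for k x
    using c by (auto simp: G_def s_def hinge_power_nonneg hinge_power_le_1)
  \<comment> \<open>On the support of the cutoff \<open>norm x \<le> R\<close>, so a factor \<open>norm x\<close> is absorbed by \<open>c\<close>.\<close>
  have Gout: "G k x = 0" if "0 < k" "\<not> norm x \<le> R" for k x
  proof -
    have "R * R \<le> norm x * norm x" using that R by (intro mult_mono) auto
    then have "c * (R * R) \<le> c * (norm x * norm x)" using c by (intro mult_left_mono) auto
    then have "1 \<le> s x" using c by (simp add: s_def dot_square_norm power2_eq_square)
    then show ?thesis using that by (simp add: G_def hinge_power_eq_0)
  qed
  have GR: "G k x * norm x \<le> R" if "0 < k" for k x
  proof (cases "norm x \<le> R")
    case True
    then have "G k x * norm x \<le> 1 * R" by (intro mult_mono G01) (use R in auto)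
    then show ?thesis by simp
  qed (use Gout[OF that] R in simp)
  have GRR: "G k x * norm x * norm x \<le> R * R" if "0 < k" for k x
  proof (cases "norm x \<le> R")
    case True
    then show ?thesis by (intro mult_mono GR that) (use R in auto)
  qed (simp add: Gout[OF that])
  have nI: "norm (I x) \<le> norm x" for x
    unfolding I_def by (rule norm_blinfun_bound) (auto simp: Cauchy_Schwarz_ineq2)
  have nJ: "norm J \<le> norm \<xi>"
    unfolding J_def by (rule norm_blinfun_bound) (auto simp: Cauchy_Schwarz_ineq2)
  have nT: "norm (T p q) \<le> P * Q" if "norm p \<le> P" "norm q \<le> Q" for p q P Q
  proof (rule norm_blinfun_bound)
    have P: "0 \<le> P" and Q: "0 \<le> Q" using that norm_ge_zero order_trans by blast+
    then show "0 \<le> P * Q" by simp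
    fix h
    have "norm (p h) \<le> norm p * norm h" by (rule norm_blinfun)
    also have "\<dots> \<le> P * norm h" using that by (intro mult_right_mono) auto
    finally have "norm (p h) * norm q \<le> (P * norm h) * Q"
      using that P by (intro mult_mono) auto
    then show "norm (T p q h) \<le> P * Q * norm h" by (simp add: T algebra_simps)
  qed
  have nII: "norm II \<le> 1"
    by (rule norm_blinfun_bound) (auto simp: II nI)
  have sc: "norm (a *\<^sub>R L) \<le> \<bar>a\<bar> * l" if "norm L \<le> l" for a l and L :: "'a \<Rightarrow>\<^sub>L 'a \<Rightarrow>\<^sub>L real"
    using that by (simp add: mult_left_mono)
  have trig: "\<bar>a * cos y\<bar> * l \<le> a * l" "\<bar>a * sin y\<bar> * l \<le> a * l" if "0 \<le> a" "0 \<le> l" for a y l :: real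
  proof -
    have "a * \<bar>cos y\<bar> * l \<le> a * 1 * l" "a * \<bar>sin y\<bar> * l \<le> a * 1 * l"
      using that by (intro mult_right_mono mult_left_mono; simp)+
    then show "\<bar>a * cos y\<bar> * l \<le> a * l" "\<bar>a * sin y\<bar> * l \<le> a * l"
      using that by (simp_all add: abs_mult)
  qed
  have cR: "c * R \<le> 1" using mult_left_mono[of R "R * R" c] c R by simp
  have 4: "norm (D2 x) \<le> 30 + 12 * norm \<xi> + (norm \<xi>)\<^sup>2" for x
  proof -
    have "norm ((24 * c * c * G 1 x * cos (\<xi> \<bullet> x)) *\<^sub>R T (I x) (I x)) \<le> (24 * c * c * G 1 x) * (norm x * norm x)"
      by (rule order_trans[OF sc[OF nT[OF nI nI]] trig(1)]) (use c G01 in auto)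
    also have "\<dots> = 24 * c * (c * (G 1 x * norm x * norm x))" by simp
    also have "\<dots> \<le> 24 * 1 * (c * (R * R))"
      by (intro mult_mono GRR) (use c G01 in auto)
    finally have a: "norm ((24 * c * c * G 1 x * cos (\<xi> \<bullet> x)) *\<^sub>R T (I x) (I x)) \<le> 24"
      using c by simp
    have mid: "6 * c * G 2 x * (norm x * norm \<xi>) \<le> 6 * norm \<xi>"
    proof -
      have "6 * c * G 2 x * (norm x * norm \<xi>) = (6 * norm \<xi>) * (c * (G 2 x * norm x))" by simp
      also have "\<dots> \<le> (6 * norm \<xi>) * (c * R)"
        by (intro mult_left_mono GR) (use c in auto)
      also have "\<dots> \<le> (6 * norm \<xi>) * 1" by (intro mult_left_mono cR) auto
      finally show ?thesis by simp
    qed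
    have b: "norm ((6 * c * G 2 x * sin (\<xi> \<bullet> x)) *\<^sub>R T J (I x)) \<le> 6 * norm \<xi>"
      by (rule order_trans[OF sc[OF nT[OF nJ nI]] order_trans[OF trig(2)]])
         (use c G01 mid in \<open>auto simp: mult.commute\<close>)
    have d: "norm ((6 * c * G 2 x * sin (\<xi> \<bullet> x)) *\<^sub>R T (I x) J) \<le> 6 * norm \<xi>"
      by (rule order_trans[OF sc[OF nT[OF nI nJ]] order_trans[OF trig(2)]])
         (use c G01 mid in auto)
    have "norm (A x *\<^sub>R II) \<le> (6 * c * G 2 x) * 1"
      using order_trans[OF sc[OF nII] trig(1)[of "6 * c * G 2 x" 1 "\<xi> \<bullet> x"]] c G01
      by (simp add: A_def)
    also have "\<dots> \<le> (6 * 1 * 1) * 1" by (intro mult_mono) (use c G01 in auto)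
    finally have e: "norm (A x *\<^sub>R II) \<le> 6" by simp
    have "norm ((G 3 x * cos (\<xi> \<bullet> x)) *\<^sub>R T J J) \<le> G 3 x * (norm \<xi> * norm \<xi>)"
      by (rule order_trans[OF sc[OF nT[OF nJ nJ]] trig(1)]) (use G01 in auto)
    also have "\<dots> \<le> 1 * (norm \<xi> * norm \<xi>)" by (intro mult_right_mono G01) auto
    finally have f: "norm ((G 3 x * cos (\<xi> \<bullet> x)) *\<^sub>R T J J) \<le> (norm \<xi>)\<^sup>2"
      by (simp add: power2_eq_square)
    show ?thesis
      unfolding D2_def
      using norm_triangle_ineq4 a b d e f
      by (smt (verit, ccfv_threshold) norm_triangle_ineq)
  qed
  show thesis by (rule that[OF 1 2 3 4])
qed

lemma C2_compact_support_wave_packet: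
  assumes R: "1 \<le> R"
  shows "C2_compact_support (wave_packet \<xi> R)"
proof -
  have "{x. wave_packet \<xi> R x \<noteq> 0} \<subseteq> cball 0 R"
  proof
    fix x assume "x \<in> {x. wave_packet \<xi> R x \<noteq> 0}"
    then have "\<not> 1 \<le> x \<bullet> x / R\<^sup>2"
      using hinge_power_eq_0[of "x \<bullet> x / R\<^sup>2" 3] by (auto simp: wave_packet_def)
    then have "(norm x)\<^sup>2 < R\<^sup>2" using R by (simp add: power2_norm_eq_inner le_divide_eq not_le)
    then show "x \<in> cball 0 R" using R power2_less_imp_less[of "norm x" R] by simp
  qed
  then have "bounded {x. wave_packet \<xi> R x \<noteq> 0}" by (rule bounded_subset[OF bounded_cball])
  then have "compact (closure {x. wave_packet \<xi> R x \<noteq> 0})" by (simp add: compact_closure)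
  moreover obtain D D2
    where "\<And>x. (wave_packet \<xi> R has_derivative blinfun_apply (D x)) (at x)"
      and "\<And>x. (D has_derivative blinfun_apply (D2 x)) (at x)" and "continuous_on UNIV D2"
    using wave_packet_derivatives[OF R] by metis
  ultimately show ?thesis unfolding C2_compact_support_def by blast
qed

lemma wave_packet_second_difference:
  fixes \<xi> :: "'a::euclidean_space"
  obtains M where "0 \<le> M"
    and "\<And>R w v. 1 \<le> R \<Longrightarrow>
      \<bar>wave_packet \<xi> R (w + v) + wave_packet \<xi> R (w - v) - 2 * wave_packet \<xi> R w\<bar> \<le> M * (norm v)\<^sup>2"
proof
  show "\<bar>wave_packet \<xi> R (w + v) + wave_packet \<xi> R (w - v) - 2 * wave_packet \<xi> R w\<bar>
      \<le> 2 * (30 + 12 * norm \<xi> + (norm \<xi>)\<^sup>2) * (norm v)\<^sup>2" if R: "1 \<le> R" for R w v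
  proof -
    obtain D D2
      where "\<And>x. (wave_packet \<xi> R has_derivative blinfun_apply (D x)) (at x)"
        and "\<And>x. (D has_derivative blinfun_apply (D2 x)) (at x)"
        and "\<And>x. norm (D2 x) \<le> 30 + 12 * norm \<xi> + (norm \<xi>)\<^sup>2"
      using wave_packet_derivatives[OF R] by metis
    then show ?thesis by (rule second_difference_bound)
  qed
qed simp


section \<open>The nonlocal operator on smoothed functions\<close>

text \<open>
  A bounded function with bounded second derivative has second differences of order \<open>min 1 (r\<^sup>2)\<close>,
  which makes them integrable against the one-dimensional Levy measures.
\<close>

lemma integrable_levy_weight:
  assumes "0 < a" "a < 2"
  shows "integrable lborel (\<lambda>r::real. \<bar>r\<bar> powr - (1 + a) * min 1 (r\<^sup>2))"
proof -
  define f where "f r = \<bar>r\<bar> powr - (1 + a) * min 1 (r\<^sup>2)" for r :: real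
  have meas [measurable]: "f \<in> borel_measurable borel" unfolding f_def by measurable
  have near: "f r = r powr (1 - a)" if "0 < r" "r \<le> 1" for r
  proof -
    have "r\<^sup>2 \<le> 1" using that by (simp add: power_le_one)
    moreover have "r powr - (1 + a) * r powr 2 = r powr (1 - a)"
      by (simp flip: powr_add)
    ultimately show ?thesis using that by (simp add: f_def)
  qed
  have far: "f r = r powr - (1 + a)" if "1 \<le> r" for r
  proof -
    have "1 \<le> r\<^sup>2" using that by simp
    then show ?thesis using that by (simp add: f_def)
  qed
  have "(\<lambda>r. r powr (1 - a)) integrable_on {0..1}"
    using has_integral_powr_from_0[of "1 - a" 1] assms by (auto simp: integrable_on_def)
  then have "f integrable_on {0..1}"
    by (rule integrable_spike[where S = "{0}"]) (auto simp: near)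
  moreover have "f integrable_on {1..}"
  proof (rule integrable_eq)
    show "(\<lambda>r. r powr - (1 + a)) integrable_on {1..}"
      using has_integral_powr_to_inf[of "- (1 + a)" 1] assms unfolding integrable_on_def by auto
  qed (simp add: far)
  ultimately have "f integrable_on {0..1} \<union> {1..}"
    by (rule integrable_Un[rotated]) auto
  moreover have "{0..1} \<union> {1..} = {0::real..}" by auto
  ultimately have "f integrable_on {0..}" by simp
  then have "f absolutely_integrable_on {0..}"
    by (rule nonnegative_absolutely_integrable_1) (simp add: f_def)
  then have half: "integrable lborel (\<lambda>r. indicator {0..} r * f r)"
    by (simp add: set_integrable_def integrable_completion)
  then have "integrable lborel (\<lambda>r. indicator {0..} (0 + (-1) * r) * f (0 + (-1) * r))"
    by (intro lborel_integrable_real_affine) auto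
  from Bochner_Integration.integrable_add[OF half this] show ?thesis
    by (rule Bochner_Integration.integrable_bound)
       (auto simp: f_def[abs_def] indicator_def)
qed

lemma
  fixes f :: "real ^ 'n::finite \<Rightarrow> real"
  assumes C: "\<And>i. 0 \<le> C i" and f: "integrable (axis_levy_measure \<alpha> C) f"
  shows integrable_axis_levy_measure:
      "integrable lborel (\<lambda>r. C i * \<bar>r\<bar> powr - (1 + \<alpha> i) * f (axis i r))"
    and integral_axis_levy_measure:
      "integral\<^sup>L (axis_levy_measure \<alpha> C) f
        = (\<Sum>i\<in>UNIV. LINT r|lborel. C i * \<bar>r\<bar> powr - (1 + \<alpha> i) * f (axis i r))"
proof -
  let ?P = "count_space (UNIV::'n set) \<Otimes>\<^sub>M (lborel :: real measure)"
  let ?d = "\<lambda>(i, r). C i * \<bar>r\<bar> powr - (1 + \<alpha> i)"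
  let ?g = "\<lambda>(i, r). axis i r :: real ^ 'n"
  interpret sigma_finite_measure "count_space (UNIV::'n set)"
    by (rule sigma_finite_measure_count_space_finite) simp
  interpret P: pair_sigma_finite "count_space (UNIV::'n set)" "lborel :: real measure" ..
  note measurable_axis_pair[measurable]
  have dm [measurable]: "?d \<in> borel_measurable ?P"
    by (intro measurable_pair_measure_countable1) auto
  have eq: "axis_levy_measure \<alpha> C = distr (density ?P (\<lambda>p. ennreal (?d p))) borel ?g"
    unfolding axis_levy_measure_def by (simp add: case_prod_beta')
  have fm [measurable]: "f \<in> borel_measurable borel"
    using borel_measurable_integrable[OF f] by (simp add: eq)
  have nn: "AE p in ?P. 0 \<le> ?d p" using C by (auto simp: case_prod_beta)
  have int: "integrable ?P (\<lambda>p. ?d p * f (?g p))"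
    using f nn unfolding eq by (simp add: integrable_distr_eq integrable_density)
  have "integral\<^sup>L (axis_levy_measure \<alpha> C) f = (\<integral>p. ?d p * f (?g p) \<partial>?P)"
    unfolding eq using nn by (simp add: integral_distr integral_density)
  also have "\<dots> = (\<integral>i. (LINT r|lborel. ?d (i, r) * f (?g (i, r))) \<partial>count_space UNIV)"
    by (rule P.integral_fst'[symmetric, OF int])
  finally show "integral\<^sup>L (axis_levy_measure \<alpha> C) f
        = (\<Sum>i\<in>UNIV. LINT r|lborel. C i * \<bar>r\<bar> powr - (1 + \<alpha> i) * f (axis i r))"
    by (simp add: lebesgue_integral_count_space_finite)
  show "integrable lborel (\<lambda>r. C i * \<bar>r\<bar> powr - (1 + \<alpha> i) * f (axis i r))"
    using P.AE_integrable_fst'[OF int] by (auto simp: AE_count_space)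
qed

lemma norm_axis: "norm (axis i r :: real ^ 'n::finite) = \<bar>r\<bar>"
  unfolding norm_eq_sqrt_inner by (simp add: inner_axis_axis)

text \<open>Symmetrising the truncated integrals turns the principal value into second differences.\<close>

lemma has_levy_value_second_differences:
  fixes v :: "real ^ 'n::finite \<Rightarrow> real"
  assumes C: "\<And>i. 0 \<le> C i" and v: "has_levy_value (axis_levy_measure \<alpha> C) v x l"
    and \<epsilon>: "\<And>n. 0 < \<epsilon> n" "\<epsilon> \<longlonglongrightarrow> 0"
  shows "(\<lambda>n. \<Sum>i\<in>UNIV. LINT r|lborel. indicator {r. \<epsilon> n < \<bar>r\<bar>} r * (C i / 2 * \<bar>r\<bar> powr - (1 + \<alpha> i)
            * (v (x + axis i r) + v (x - axis i r) - 2 * v x))) \<longlonglongrightarrow> l"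
proof -
  let ?\<mu> = "axis_levy_measure \<alpha> C"
  have trunc: "(LINT z:{z. e < norm z}|?\<mu>. v (x + z) - v x)
    = (\<Sum>i\<in>UNIV. LINT r|lborel. indicator {r. e < \<bar>r\<bar>} r * (C i / 2 * \<bar>r\<bar> powr - (1 + \<alpha> i)
            * (v (x + axis i r) + v (x - axis i r) - 2 * v x)))" if e: "0 < e" for e
  proof -
    let ?f = "\<lambda>z. indicator {z. e < norm z} z *\<^sub>R (v (x + z) - v x)"
    have f: "integrable ?\<mu> ?f"
      using v e unfolding has_levy_value_def set_integrable_def by blast
    have "(LINT z:{z. e < norm z}|?\<mu>. v (x + z) - v x)
       = (\<Sum>i\<in>UNIV. LINT r|lborel. C i * \<bar>r\<bar> powr - (1 + \<alpha> i) * ?f (axis i r))"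
      unfolding set_lebesgue_integral_def by (rule integral_axis_levy_measure[OF C f])
    also have "\<dots> = (\<Sum>i\<in>UNIV. LINT r|lborel. indicator {r. e < \<bar>r\<bar>} r * (C i / 2 * \<bar>r\<bar> powr - (1 + \<alpha> i)
            * (v (x + axis i r) + v (x - axis i r) - 2 * v x)))"
    proof (rule sum.cong[OF refl])
      fix i :: 'n
      let ?g = "\<lambda>r. C i * \<bar>r\<bar> powr - (1 + \<alpha> i) * ?f (axis i r)"
      have g: "integrable lborel ?g" by (rule integrable_axis_levy_measure[OF C f])
      have g': "integrable lborel (\<lambda>r. ?g (0 + (-1) * r))"
        by (rule lborel_integrable_real_affine[OF g]) simp
      have "integral\<^sup>L lborel ?g = integral\<^sup>L lborel (\<lambda>r. ?g (0 + (-1) * r))"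
        by (subst lborel_integral_real_affine[where c = "-1" and t = 0]) auto
      then have "integral\<^sup>L lborel ?g = (integral\<^sup>L lborel ?g + integral\<^sup>L lborel (\<lambda>r. ?g (0 + (-1) * r))) / 2"
        by simp
      also have "\<dots> = (LINT r|lborel. (?g r + ?g (0 + (-1) * r)) / 2)"
        using g g' by simp
      also have "\<dots> = (LINT r|lborel. indicator {r. e < \<bar>r\<bar>} r * (C i / 2 * \<bar>r\<bar> powr - (1 + \<alpha> i)
            * (v (x + axis i r) + v (x - axis i r) - 2 * v x)))"
      proof (rule Bochner_Integration.integral_cong[OF refl])
        fix r :: real
        have "axis i (- r) = - (axis i r :: real ^ 'n)" by (simp add: axis_def vec_eq_iff)
        then show "(?g r + ?g (0 + (-1) * r)) / 2 = indicator {r. e < \<bar>r\<bar>} r *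
            (C i / 2 * \<bar>r\<bar> powr - (1 + \<alpha> i) * (v (x + axis i r) + v (x - axis i r) - 2 * v x))"
          by (cases "e < \<bar>r\<bar>") (simp_all add: norm_axis distrib_left right_diff_distrib)
      qed
      finally show "integral\<^sup>L lborel ?g = \<dots>" .
    qed
    finally show ?thesis .
  qed
  have "filterlim \<epsilon> (at_right 0) sequentially"
    using \<epsilon>(2) by (rule tendsto_imp_filterlim_at_right) (simp add: \<epsilon>(1))
  moreover have "((\<lambda>\<epsilon>. LINT z:{z. \<epsilon> < norm z}|?\<mu>. v (x + z) - v x) \<longlongrightarrow> l) (at_right 0)"
    using v by (simp add: has_levy_value_def)
  ultimately have "(\<lambda>n. LINT z:{z. \<epsilon> n < norm z}|?\<mu>. v (x + z) - v x) \<longlonglongrightarrow> l"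
    by (rule filterlim_compose[rotated])
  then show ?thesis unfolding trunc[OF \<epsilon>(1)] .
qed

lemma lborel_integral_reflect:
  fixes f :: "'a::euclidean_space \<Rightarrow> real"
  assumes [measurable]: "f \<in> borel_measurable borel"
  shows "(LINT y|lborel. f (x - y)) = integral\<^sup>L lborel f"
proof -
  have "integral\<^sup>L lborel f = integral\<^sup>L (distr lborel borel (\<lambda>y. x - y)) f"
    by (subst lborel_affine[of "-1" x]) (auto simp: density_1)
  then show ?thesis by (simp add: integral_distr)
qed

text \<open>
  A sub-probability density acting by convolution. For fixed \<open>t\<close> this is the situation of
  the heat kernel \<open>H(\<cdot>, t)\<close>.
\<close>

context
  fixes h :: "'a::euclidean_space \<Rightarrow> real"
  assumes h0: "\<And>y. 0 \<le> h y" and hint: "integrable lborel h" and h1: "integral\<^sup>L lborel h \<le> 1"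
begin

lemma smoothing_integrable:
  assumes "\<phi> \<in> borel_measurable borel" "\<And>y. \<bar>\<phi> y\<bar> \<le> B"
  shows "integrable lborel (\<lambda>y. h y * \<phi> (x - y))"
proof (rule Bochner_Integration.integrable_bound[where f = "\<lambda>y. B * h y"])
  note assms(1)[measurable]
  note borel_measurable_integrable[OF hint, measurable]
  show "(\<lambda>y. h y * \<phi> (x - y)) \<in> borel_measurable lborel" by measurable
  have B: "0 \<le> B" using assms(2)[of 0] by simp
  show "AE y in lborel. norm (h y * \<phi> (x - y)) \<le> norm (B * h y)"
    using assms(2) B by (auto simp: abs_mult h0 mult.commute[of B] intro!: mult_left_mono)
qed (use hint in simp)

lemma smoothing_bound:
  assumes "\<phi> \<in> borel_measurable borel" "\<And>y. \<bar>\<phi> y\<bar> \<le> B"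
  shows "\<bar>LINT y|lborel. h y * \<phi> (x - y)\<bar> \<le> B"
proof -
  have B: "0 \<le> B" using assms(2)[of 0] by simp
  have "\<bar>LINT y|lborel. h y * \<phi> (x - y)\<bar> \<le> (LINT y|lborel. \<bar>h y * \<phi> (x - y)\<bar>)"
    by (rule integral_abs_bound)
  also have "\<dots> \<le> (LINT y|lborel. B * h y)"
  proof (rule integral_mono)
    show "integrable lborel (\<lambda>y. \<bar>h y * \<phi> (x - y)\<bar>)"
      by (rule integrable_abs[OF smoothing_integrable[OF assms]])
    show "\<bar>h y * \<phi> (x - y)\<bar> \<le> B * h y" for y
      using mult_left_mono[OF assms(2)[of "x - y"] h0[of y]] by (simp add: abs_mult h0 mult.commute[of B])
  qed (use hint in simp)
  also have "\<dots> \<le> B * 1" using mult_left_mono[OF h1 B] by simp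
  finally show ?thesis by simp
qed

lemma smoothing_measurable:
  assumes [measurable]: "\<phi> \<in> borel_measurable borel"
  shows "(\<lambda>x. LINT y|lborel. h y * \<phi> (x - y)) \<in> borel_measurable borel"
proof -
  note borel_measurable_integrable[OF hint, measurable]
  have "(\<lambda>p. h (snd p) * \<phi> (fst p - snd p)) \<in> borel_measurable (borel \<Otimes>\<^sub>M lborel)" by measurable
  then show ?thesis
    by (intro lborel.borel_measurable_lebesgue_integral) (simp add: case_prod_beta')
qed

lemma smoothing_second_difference:
  assumes "\<phi> \<in> borel_measurable borel" "\<And>y. \<bar>\<phi> y\<bar> \<le> B"
  shows "(LINT y|lborel. h y * \<phi> (x + v - y)) + (LINT y|lborel. h y * \<phi> (x - v - y))
      - 2 * (LINT y|lborel. h y * \<phi> (x - y))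
    = (LINT y|lborel. h y * (\<phi> (x - y + v) + \<phi> (x - y - v) - 2 * \<phi> (x - y)))"
proof -
  have "(LINT y|lborel. h y * (\<phi> (x - y + v) + \<phi> (x - y - v) - 2 * \<phi> (x - y)))
     = (LINT y|lborel. h y * \<phi> (x + v - y) + h y * \<phi> (x - v - y) - 2 * (h y * \<phi> (x - y)))"
    by (intro Bochner_Integration.integral_cong refl) (simp add: algebra_simps)
  then show ?thesis
    using smoothing_integrable[OF assms] by simp
qed

end

lemma le_min_one_square:
  fixes a M r :: real
  assumes "a \<le> 4" "a \<le> M * r\<^sup>2" "0 \<le> M"
  shows "a \<le> (4 + M) * min 1 (r\<^sup>2)"
proof (cases "1 \<le> r\<^sup>2")
  case True
  then show ?thesis using assms by simp
next
  case False
  then have "M * r\<^sup>2 \<le> (4 + M) * r\<^sup>2" by (intro mult_right_mono) auto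
  then show ?thesis using assms False by simp
qed

text \<open>
  By dominated convergence the principal value of a smoothed function is an absolutely convergent
  integral of smoothed second differences. Keeping the smoothing integral innermost avoids any
  exchange of integrals.
\<close>

lemma levy_value_smoothing:
  fixes h \<phi> :: "real ^ 'n::finite \<Rightarrow> real"
  assumes h: "\<And>y. 0 \<le> h y" "integrable lborel h" "integral\<^sup>L lborel h \<le> 1"
    and C: "\<And>i. 0 \<le> C i" and \<alpha>: "\<And>i. 0 < \<alpha> i" "\<And>i. \<alpha> i < 2"
    and \<phi>: "\<phi> \<in> borel_measurable borel" "\<And>y. \<bar>\<phi> y\<bar> \<le> 1"
    and M: "0 \<le> M" "\<And>w v. \<bar>\<phi> (w + v) + \<phi> (w - v) - 2 * \<phi> w\<bar> \<le> M * (norm v)\<^sup>2"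
    and l: "has_levy_value (axis_levy_measure \<alpha> C) (\<lambda>x. LINT y|lborel. h y * \<phi> (x - y)) x l"
  shows "l = (\<Sum>i\<in>UNIV. LINT r|lborel. C i / 2 * \<bar>r\<bar> powr - (1 + \<alpha> i) *
           (LINT y|lborel. h y * (\<phi> (x - y + axis i r) + \<phi> (x - y - axis i r) - 2 * \<phi> (x - y))))"
    (is "_ = (\<Sum>i\<in>UNIV. LINT r|lborel. ?w i r * ?V i r)")
    and "\<bar>LINT y|lborel. h y * (\<phi> (x - y + axis i r) + \<phi> (x - y - axis i r) - 2 * \<phi> (x - y))\<bar>
           \<le> (4 + M) * min 1 (r\<^sup>2)"
    and "(\<lambda>r. LINT y|lborel. h y * (\<phi> (x - y + axis i r) + \<phi> (x - y - axis i r) - 2 * \<phi> (x - y)))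
           \<in> borel_measurable borel"
proof -
  note \<phi>(1)[measurable]
  have D: "\<bar>\<phi> (w + axis i r) + \<phi> (w - axis i r) - 2 * \<phi> w\<bar> \<le> (4 + M) * min 1 (r\<^sup>2)" for w i r
  proof (rule le_min_one_square)
    show "\<bar>\<phi> (w + axis i r) + \<phi> (w - axis i r) - 2 * \<phi> w\<bar> \<le> 4"
      using \<phi>(2)[of "w + axis i r"] \<phi>(2)[of "w - axis i r"] \<phi>(2)[of w] by linarith
    show "\<bar>\<phi> (w + axis i r) + \<phi> (w - axis i r) - 2 * \<phi> w\<bar> \<le> M * r\<^sup>2"
      using M(2)[of w "axis i r"] by (simp add: norm_axis)
  qed (rule M)
  have V: "\<bar>?V i r\<bar> \<le> (4 + M) * min 1 (r\<^sup>2)" for i r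
    by (rule smoothing_bound[OF h, of "\<lambda>w. \<phi> (w + axis i r) + \<phi> (w - axis i r) - 2 * \<phi> w"])
       (use D in auto)
  then show "\<bar>?V i r\<bar> \<le> (4 + M) * min 1 (r\<^sup>2)" .
  have ax [measurable]: "(\<lambda>r. axis i r :: real ^ 'n) \<in> borel_measurable borel" for i
  proof -
    have eq: "(\<lambda>r. axis i r :: real ^ 'n) = (\<lambda>r. r *\<^sub>R axis i 1)"
      by (auto simp: axis_def vec_eq_iff fun_eq_iff)
    have "(\<lambda>r. r *\<^sub>R axis i 1 :: real ^ 'n) \<in> borel_measurable borel" by simp
    then show ?thesis by (simp only: eq[symmetric])
  qed
  have Vm [measurable]: "?V i \<in> borel_measurable borel" for i
  proof -
    note smoothing_measurable[OF h \<phi>(1), measurable]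
    have "?V i = (\<lambda>r. (LINT y|lborel. h y * \<phi> (x + axis i r - y)) + (LINT y|lborel. h y * \<phi> (x - axis i r - y))
      - 2 * (LINT y|lborel. h y * \<phi> (x - y)))"
      by (simp add: smoothing_second_difference[OF h \<phi>])
    then show ?thesis by simp
  qed
  then show "?V i \<in> borel_measurable borel" .
  have lim: "(\<lambda>n. \<Sum>i\<in>UNIV. LINT r|lborel. indicator {r. inverse (real (Suc n)) < \<bar>r\<bar>} r * (?w i r * ?V i r))
     \<longlonglongrightarrow> l"
    using has_levy_value_second_differences[OF C l, of "\<lambda>n. inverse (real (Suc n))"]
      LIMSEQ_inverse_real_of_nat
    by (simp add: smoothing_second_difference[OF h \<phi>])
  have "(\<lambda>n. \<Sum>i\<in>UNIV. LINT r|lborel. indicator {r. inverse (real (Suc n)) < \<bar>r\<bar>} r * (?w i r * ?V i r))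
     \<longlonglongrightarrow> (\<Sum>i\<in>UNIV. LINT r|lborel. ?w i r * ?V i r)"
  proof (intro tendsto_sum integral_dominated_convergence)
    fix i :: 'n
    show "integrable lborel (\<lambda>r. (C i / 2 * (4 + M)) * (\<bar>r\<bar> powr - (1 + \<alpha> i) * min 1 (r\<^sup>2)))"
      by (intro integrable_mult_right integrable_levy_weight \<alpha>)
    show "AE r in lborel. (\<lambda>n. indicator {r. inverse (real (Suc n)) < \<bar>r\<bar>} r * (?w i r * ?V i r))
        \<longlonglongrightarrow> ?w i r * ?V i r"
    proof (rule AE_I2)
      fix r :: real
      show "(\<lambda>n. indicator {r. inverse (real (Suc n)) < \<bar>r\<bar>} r * (?w i r * ?V i r))
        \<longlonglongrightarrow> ?w i r * ?V i r"
      proof (cases "r = 0")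
        case False
        then have "\<forall>\<^sub>F n in sequentially. inverse (real (Suc n)) < \<bar>r\<bar>"
          using order_tendstoD(2)[OF LIMSEQ_inverse_real_of_nat, of "\<bar>r\<bar>"] by simp
        then have "\<forall>\<^sub>F n in sequentially. indicator {r. inverse (real (Suc n)) < \<bar>r\<bar>} r * (?w i r * ?V i r)
            = ?w i r * ?V i r"
          by eventually_elim simp
        then show ?thesis by (rule tendsto_eventually)
      qed simp
    qed
    show "AE r in lborel. norm (indicator {r. inverse (real (Suc n)) < \<bar>r\<bar>} r * (?w i r * ?V i r))
       \<le> (C i / 2 * (4 + M)) * (\<bar>r\<bar> powr - (1 + \<alpha> i) * min 1 (r\<^sup>2))" for n
    proof (rule AE_I2)
      fix r :: real
      have "norm (indicator {r. inverse (real (Suc n)) < \<bar>r\<bar>} r * (?w i r * ?V i r)) \<le> ?w i r * \<bar>?V i r\<bar>"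
        using C[of i] by (auto simp: indicator_def abs_mult)
      also have "\<dots> \<le> ?w i r * ((4 + M) * min 1 (r\<^sup>2))"
        using C[of i] by (intro mult_left_mono V) auto
      finally show "norm (indicator {r. inverse (real (Suc n)) < \<bar>r\<bar>} r * (?w i r * ?V i r))
       \<le> (C i / 2 * (4 + M)) * (\<bar>r\<bar> powr - (1 + \<alpha> i) * min 1 (r\<^sup>2))"
        by (simp add: mult_ac)
    qed
  qed measurable
  then show "l = (\<Sum>i\<in>UNIV. LINT r|lborel. ?w i r * ?V i r)"
    by (rule LIMSEQ_unique[OF lim])
qed


section \<open>Decay of the Fourier transform of the heat kernel\<close>

text \<open>
  The Fourier multiplier of \<open>- L\<^sup>\<mu>\<close>. The integrals converge absolutely for \<open>0 < \<alpha> i < 2\<close>; the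
  odd part \<open>sin\<close> of the exponential is absent because the measure is symmetric.
\<close>

definition levy_symbol :: "('n::finite \<Rightarrow> real) \<Rightarrow> ('n \<Rightarrow> real) \<Rightarrow> real ^ 'n \<Rightarrow> real" where
  "levy_symbol \<alpha> C \<xi> =
     (\<Sum>i\<in>UNIV. LINT r|lborel. C i * \<bar>r\<bar> powr - (1 + \<alpha> i) * (1 - cos (\<xi> $ i * r)))"

lemma one_minus_cos_le: "1 - cos x \<le> x\<^sup>2 / (2::real)"
proof -
  have "1 - cos x = 2 * (sin (x / 2))\<^sup>2"
    using cos_double_sin[of "x / 2"] by simp
  also have "\<dots> \<le> 2 * (x / 2)\<^sup>2"
    using abs_sin_x_le_abs_x[of "x / 2"] by (intro mult_left_mono) (simp_all only: abs_le_square_iff)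
  finally show ?thesis by (simp add: power2_eq_square)
qed

lemma integrable_levy_symbol:
  fixes C a k :: real
  assumes a: "0 < a" "a < 2"
  shows "integrable lborel (\<lambda>r. C * \<bar>r\<bar> powr - (1 + a) * (1 - cos (k * r)))"
proof (rule Bochner_Integration.integrable_bound)
  show "integrable lborel (\<lambda>r. \<bar>C\<bar> * (4 + k\<^sup>2) * (\<bar>r\<bar> powr - (1 + a) * min 1 (r\<^sup>2)))"
    by (intro integrable_mult_right integrable_levy_weight a)
  show "AE r in lborel. norm (C * \<bar>r\<bar> powr - (1 + a) * (1 - cos (k * r)))
     \<le> norm (\<bar>C\<bar> * (4 + k\<^sup>2) * (\<bar>r\<bar> powr - (1 + a) * min 1 (r\<^sup>2)))"
  proof (rule AE_I2)
    fix r :: real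
    have "1 - cos (k * r) \<le> (4 + k\<^sup>2) * min 1 (r\<^sup>2)"
    proof (rule le_min_one_square)
      show "1 - cos (k * r) \<le> 4" using cos_ge_minus_one[of "k * r"] by linarith
      have "(k * r)\<^sup>2 / 2 \<le> k\<^sup>2 * r\<^sup>2" by (simp add: power_mult_distrib)
      then show "1 - cos (k * r) \<le> k\<^sup>2 * r\<^sup>2"
        using one_minus_cos_le[of "k * r"] by linarith
    qed simp
    then have "(\<bar>C\<bar> * \<bar>r\<bar> powr - (1 + a)) * (1 - cos (k * r))
        \<le> (\<bar>C\<bar> * \<bar>r\<bar> powr - (1 + a)) * ((4 + k\<^sup>2) * min 1 (r\<^sup>2))"
      by (rule mult_left_mono) simp
    then show "norm (C * \<bar>r\<bar> powr - (1 + a) * (1 - cos (k * r)))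
     \<le> norm (\<bar>C\<bar> * (4 + k\<^sup>2) * (\<bar>r\<bar> powr - (1 + a) * min 1 (r\<^sup>2)))"
      by (simp add: abs_mult mult_ac)
  qed
qed measurable

text \<open>
  The integrand is at least \<open>C (\<pi> / |k|) powr -(1 + a)\<close> for \<open>\<pi> / 2 \<le> |k r| \<le> \<pi>\<close>, where
  \<open>cos (k r) \<le> 0\<close>.
\<close>

lemma levy_symbol_1D_lower:
  fixes C a k :: real
  assumes a: "0 < a" "a < 2" and C: "0 \<le> C"
  shows "C / 2 * pi powr - a * \<bar>k\<bar> powr a \<le> (LINT r|lborel. C * \<bar>r\<bar> powr - (1 + a) * (1 - cos (k * r)))"
proof (cases "k = 0")
  case False
  define p where "p = pi / \<bar>k\<bar>"
  have p: "0 < p" using False by (simp add: p_def)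
  have "C / 2 * pi powr - a * \<bar>k\<bar> powr a = C / 2 * p powr - a"
    using False by (simp add: p_def powr_divide powr_minus field_simps)
  also have "\<dots> = C * (p / 2 * p powr - (1 + a))"
    using p by (simp add: powr_add powr_diff powr_minus field_simps)
  also have "\<dots> = (LINT r|lborel. indicator {p/2..p} r * (C * p powr - (1 + a)))"
    using p by simp
  also have "\<dots> \<le> (LINT r|lborel. C * \<bar>r\<bar> powr - (1 + a) * (1 - cos (k * r)))"
  proof (rule integral_mono)
    show "integrable lborel (\<lambda>r. indicator {p/2..p} r * (C * p powr - (1 + a)))"
      using p by (intro integrable_mult_left integrable_real_indicator) auto
    show "integrable lborel (\<lambda>r. C * \<bar>r\<bar> powr - (1 + a) * (1 - cos (k * r)))"
      by (rule integrable_levy_symbol[OF a])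
    fix r :: real
    show "indicator {p/2..p} r * (C * p powr - (1 + a)) \<le> C * \<bar>r\<bar> powr - (1 + a) * (1 - cos (k * r))"
    proof (cases "r \<in> {p/2..p}")
      case True
      then have r: "0 < r" "p / 2 \<le> r" "r \<le> p" using p by auto
      have kr: "pi / 2 \<le> \<bar>k\<bar> * r" "\<bar>k\<bar> * r \<le> pi"
        using False r by (auto simp: p_def field_simps)
      have "cos (k * r) = cos (\<bar>k\<bar> * r)" by (cases "k < 0") (auto simp: abs_if)
      also have "\<dots> \<le> cos (pi / 2)"
        using kr by (intro cos_monotone_0_pi_le) auto
      finally have "cos (k * r) \<le> 0" by simp
      then have "C * p powr - (1 + a) * 1 \<le> C * r powr - (1 + a) * (1 - cos (k * r))"
        using r a C by (intro mult_mono powr_mono2') auto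
      then show ?thesis using True r by simp
    next
      case False
      then show ?thesis using C by simp
    qed
  qed
  finally show ?thesis .
qed simp

text \<open>
  The packets \<open>wave_packet \<xi> R\<close> are admissible initial data. As \<open>R\<close> grows, both sides of the heat
  equation converge boundedly, and the second differences of \<open>cos (\<xi> \<bullet> \<cdot>)\<close> are multiples of it.
\<close>

lemma heat_kernel_fourier_decay:
  fixes H :: "real ^ 'n::finite \<Rightarrow> real \<Rightarrow> real"
  assumes C: "\<And>i. 0 \<le> C i" and \<alpha>: "\<And>i. 0 < \<alpha> i" "\<And>i. \<alpha> i < 2"
    and hk: "is_heat_kernel (axis_levy_measure \<alpha> C) H" and t: "0 < t"
  shows "\<bar>LINT y|lborel. H y t * cos (\<xi> \<bullet> (x - y))\<bar> \<le> exp (- (t * levy_symbol \<alpha> C \<xi>))"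
proof -
  define \<phi> where "\<phi> n = wave_packet \<xi> (real (Suc n))" for n
  define m where "m = levy_symbol \<alpha> C \<xi>"
  define f where "f t = (LINT y|lborel. H y t * cos (\<xi> \<bullet> (x - y)))" for t
  define U where "U n = heat_semigroup H (\<phi> n) x" for n
  have h: "0 \<le> H y t" "integrable lborel (\<lambda>y. H y t)" "(LINT y|lborel. H y t) \<le> 1" if "0 < t" for t y
    using hk that unfolding is_heat_kernel_def by auto
  have \<phi>m [measurable]: "\<phi> n \<in> borel_measurable borel" for n
    unfolding \<phi>_def by (rule borel_measurable_continuous_onI[OF continuous_wave_packet])
  have \<phi>1: "\<bar>\<phi> n y\<bar> \<le> 1" for n y
    unfolding \<phi>_def by (rule abs_wave_packet_le)
  have \<phi>lim: "(\<lambda>n. \<phi> n y) \<longlonglongrightarrow> cos (\<xi> \<bullet> y)" for y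
    unfolding \<phi>_def by (rule tendsto_wave_packet)
  obtain M where M: "0 \<le> M" "\<And>n w v. \<bar>\<phi> n (w + v) + \<phi> n (w - v) - 2 * \<phi> n w\<bar> \<le> M * (norm v)\<^sup>2"
    using wave_packet_second_difference[of \<xi>] unfolding \<phi>_def by (metis of_nat_Suc le_add_same_cancel1 of_nat_0_le_iff)
  have conv: "heat_semigroup H (\<phi> n) x t = (LINT y|lborel. H y t * \<phi> n (x - y))" if "0 < t" for n x t
  proof -
    note borel_measurable_integrable[OF h(2)[OF that], measurable]
    show ?thesis unfolding heat_semigroup_def
      using lborel_integral_reflect[of "\<lambda>y. H y t * \<phi> n (x - y)" x] by simp
  qed
  define V where "V n i t r = (LINT y|lborel. H y t * (\<phi> n (x - y + axis i r) + \<phi> n (x - y - axis i r) - 2 * \<phi> n (x - y)))"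
    for n i t r
  define L where "L n t = (\<Sum>i\<in>UNIV. LINT r|lborel. C i / 2 * \<bar>r\<bar> powr - (1 + \<alpha> i) * V n i t r)" for n t
  have sol: "(U n has_real_derivative L n t) (at t)"
      "\<bar>V n i t r\<bar> \<le> (4 + M) * min 1 (r\<^sup>2)" "V n i t \<in> borel_measurable borel" if t: "0 < t" for n t i r
  proof -
    have "solves_heat_equation (axis_levy_measure \<alpha> C) (\<phi> n) (heat_semigroup H (\<phi> n))"
      using hk C2_compact_support_wave_packet[of "real (Suc n)" \<xi>] unfolding is_heat_kernel_def \<phi>_def by simp
    then obtain l where l: "(U n has_real_derivative l) (at t)"
        and "has_levy_value (axis_levy_measure \<alpha> C) (\<lambda>y. heat_semigroup H (\<phi> n) y t) x l"
      unfolding solves_heat_equation_def U_def using t by blast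
    then have lv: "has_levy_value (axis_levy_measure \<alpha> C) (\<lambda>x. LINT y|lborel. H y t * \<phi> n (x - y)) x l"
      by (simp add: conv t)
    note * = levy_value_smoothing[OF h[OF t] C \<alpha> \<phi>m \<phi>1 M lv]
    show "(U n has_real_derivative L n t) (at t)"
      using l *(1) by (simp add: L_def V_def)
    show "\<bar>V n i t r\<bar> \<le> (4 + M) * min 1 (r\<^sup>2)" "V n i t \<in> borel_measurable borel"
      using *(2,3) unfolding V_def by auto
  qed
  have U1: "\<bar>U n t\<bar> \<le> 1" if "0 < t" for n t
    unfolding U_def conv[OF that] by (rule smoothing_bound[OF h[OF that] \<phi>m \<phi>1])
  have f1: "\<bar>f t\<bar> \<le> 1" if "0 < t" for t
    unfolding f_def by (rule smoothing_bound[OF h[OF that], of "\<lambda>y. cos (\<xi> \<bullet> y)"]) auto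
  have Ulim: "(\<lambda>n. U n t) \<longlonglongrightarrow> f t" if "0 < t" for t
  proof -
    note borel_measurable_integrable[OF h(2)[OF that], measurable]
    show ?thesis unfolding U_def conv[OF that] f_def
    proof (rule integral_dominated_convergence[OF _ _ h(2)[OF that]])
      show "AE y in lborel. (\<lambda>n. H y t * \<phi> n (x - y)) \<longlonglongrightarrow> H y t * cos (\<xi> \<bullet> (x - y))"
        by (intro AE_I2 tendsto_intros \<phi>lim)
      show "AE y in lborel. norm (H y t * \<phi> n (x - y)) \<le> H y t" for n
        using \<phi>1 h(1)[OF that] by (auto simp: abs_mult intro!: mult_left_le)
    qed measurable
  qed
  have Vlim: "(\<lambda>n. V n i t r) \<longlonglongrightarrow> - (2 * (1 - cos (\<xi> $ i * r))) * f t" if t: "0 < t" for i t r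
  proof -
    note borel_measurable_integrable[OF h(2)[OF t], measurable]
    have "(\<lambda>n. V n i t r) \<longlonglongrightarrow> (LINT y|lborel. H y t * (cos (\<xi> \<bullet> (x - y + axis i r))
       + cos (\<xi> \<bullet> (x - y - axis i r)) - 2 * cos (\<xi> \<bullet> (x - y))))"
      unfolding V_def
    proof (rule integral_dominated_convergence)
      show "integrable lborel (\<lambda>y. 4 * H y t)" using h(2)[OF t] by simp
      show "AE y in lborel. (\<lambda>n. H y t * (\<phi> n (x - y + axis i r) + \<phi> n (x - y - axis i r) - 2 * \<phi> n (x - y)))
         \<longlonglongrightarrow> H y t * (cos (\<xi> \<bullet> (x - y + axis i r)) + cos (\<xi> \<bullet> (x - y - axis i r)) - 2 * cos (\<xi> \<bullet> (x - y)))"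
        by (intro AE_I2 tendsto_intros \<phi>lim)
      show "AE y in lborel. norm (H y t * (\<phi> n (x - y + axis i r) + \<phi> n (x - y - axis i r) - 2 * \<phi> n (x - y)))
         \<le> 4 * H y t" for n
      proof (rule AE_I2)
        fix y
        have "\<bar>\<phi> n (x - y + axis i r) + \<phi> n (x - y - axis i r) - 2 * \<phi> n (x - y)\<bar> \<le> 4"
          using \<phi>1[of n "x - y + axis i r"] \<phi>1[of n "x - y - axis i r"] \<phi>1[of n "x - y"] by linarith
        from mult_left_mono[OF this h(1)[OF t, of y]] h(1)[OF t, of y]
        show "norm (H y t * (\<phi> n (x - y + axis i r) + \<phi> n (x - y - axis i r) - 2 * \<phi> n (x - y))) \<le> 4 * H y t"
          by (simp add: abs_mult)
      qed
    qed measurable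
    also have "(LINT y|lborel. H y t * (cos (\<xi> \<bullet> (x - y + axis i r))
       + cos (\<xi> \<bullet> (x - y - axis i r)) - 2 * cos (\<xi> \<bullet> (x - y))))
     = (LINT y|lborel. - (2 * (1 - cos (\<xi> $ i * r))) * (H y t * cos (\<xi> \<bullet> (x - y))))"
    proof (intro Bochner_Integration.integral_cong refl)
      fix y
      have eq: "\<xi> \<bullet> (x - y + axis i r) = \<xi> \<bullet> (x - y) + \<xi> $ i * r" "\<xi> \<bullet> (x - y - axis i r) = \<xi> \<bullet> (x - y) - \<xi> $ i * r"
        by (simp_all add: inner_add_right inner_diff_right inner_axis)
      show "H y t * (cos (\<xi> \<bullet> (x - y + axis i r)) + cos (\<xi> \<bullet> (x - y - axis i r)) - 2 * cos (\<xi> \<bullet> (x - y)))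
        = - (2 * (1 - cos (\<xi> $ i * r))) * (H y t * cos (\<xi> \<bullet> (x - y)))"
        unfolding eq cos_add cos_diff by (simp add: algebra_simps)
    qed
    also have "\<dots> = - (2 * (1 - cos (\<xi> $ i * r))) * f t" unfolding f_def by simp
    finally show ?thesis .
  qed
  let ?dom = "\<lambda>i r. (C i / 2 * (4 + M)) * (\<bar>r\<bar> powr - (1 + \<alpha> i) * min 1 (r\<^sup>2))"
  have dom: "integrable lborel (?dom i)" for i
    by (intro integrable_mult_right integrable_levy_weight \<alpha>)
  have wV: "\<bar>C i / 2 * \<bar>r\<bar> powr - (1 + \<alpha> i) * V n i t r\<bar> \<le> ?dom i r" if t: "0 < t" for n i t r
    using mult_left_mono[OF sol(2)[OF t, of n i r], of "C i / 2 * \<bar>r\<bar> powr - (1 + \<alpha> i)"] C[of i]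
    by (simp add: abs_mult mult_ac)
  have Llim: "(\<lambda>n. L n t) \<longlonglongrightarrow> - m * f t" if t: "0 < t" for t
  proof -
    note sol(3)[OF t, measurable]
    have "(\<lambda>n. L n t) \<longlonglongrightarrow> (\<Sum>i\<in>UNIV. LINT r|lborel. C i / 2 * \<bar>r\<bar> powr - (1 + \<alpha> i) * (- (2 * (1 - cos (\<xi> $ i * r))) * f t))"
      unfolding L_def
    proof (intro tendsto_sum integral_dominated_convergence[OF _ _ dom] AE_I2 tendsto_intros Vlim[OF t])
      show "norm (C i / 2 * \<bar>r\<bar> powr - (1 + \<alpha> i) * V n i t r) \<le> ?dom i r" for n i r
        using wV[OF t] by simp
    qed measurable
    also have "(\<Sum>i\<in>UNIV. LINT r|lborel. C i / 2 * \<bar>r\<bar> powr - (1 + \<alpha> i) * (- (2 * (1 - cos (\<xi> $ i * r))) * f t))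
      = (\<Sum>i\<in>UNIV. LINT r|lborel. - f t * (C i * \<bar>r\<bar> powr - (1 + \<alpha> i) * (1 - cos (\<xi> $ i * r))))"
      by (intro sum.cong Bochner_Integration.integral_cong refl) (simp add: algebra_simps)
    also have "\<dots> = - m * f t"
      unfolding m_def levy_symbol_def by (simp add: sum_distrib_right sum_negf sum_distrib_left mult.commute)
    finally show ?thesis .
  qed
  define B where "B = (\<Sum>i\<in>UNIV. integral\<^sup>L lborel (?dom i))"
  have LB: "\<bar>L n t\<bar> \<le> B" if t: "0 < t" for n t
  proof -
    note sol(3)[OF t, measurable]
    have "\<bar>LINT r|lborel. C i / 2 * \<bar>r\<bar> powr - (1 + \<alpha> i) * V n i t r\<bar> \<le> integral\<^sup>L lborel (?dom i)" for i
    proof -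
      have "integrable lborel (\<lambda>r. C i / 2 * \<bar>r\<bar> powr - (1 + \<alpha> i) * V n i t r)"
      proof (rule Bochner_Integration.integrable_bound[OF dom])
        show "AE r in lborel. norm (C i / 2 * \<bar>r\<bar> powr - (1 + \<alpha> i) * V n i t r) \<le> norm (?dom i r)"
          using wV[OF t] by (intro AE_I2) (simp add: order_trans[OF _ abs_ge_self])
      qed measurable
      then show ?thesis
        using wV[OF t] by (intro order_trans[OF integral_abs_bound] integral_mono integrable_abs dom)
    qed
    then show ?thesis unfolding L_def B_def by (intro order_trans[OF sum_abs] sum_mono)
  qed
  \<comment> \<open>\<open>U n r * exp (m * r)\<close> has a derivative that tends to \<open>0\<close> boundedly, so its limit is constant.\<close>
  have const: "f t * exp (m * t) = f s * exp (m * s)" if s: "0 < s" "s < t" for s t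
  proof -
    let ?g = "\<lambda>n r. exp (m * r) * (L n r + m * U n r)"
    have g: "(?g n has_integral U n t * exp (m * t) - U n s * exp (m * s)) {s..t}" for n
    proof (rule fundamental_theorem_of_calculus)
      show "((\<lambda>r. U n r * exp (m * r)) has_vector_derivative ?g n r) (at r within {s..t})" if "r \<in> {s..t}" for r
      proof -
        have "0 < r" using that s by auto
        then have "((\<lambda>r. U n r * exp (m * r)) has_real_derivative ?g n r) (at r)"
          by (auto intro!: derivative_eq_intros sol(1) simp: algebra_simps)
        then show ?thesis
          by (simp add: has_real_derivative_iff_has_vector_derivative has_vector_derivative_at_within)
      qed
    qed (use s in auto)
    have "(\<lambda>n. integral {s..t} (?g n)) \<longlonglongrightarrow> integral {s..t} (\<lambda>r. 0)"
    proof (rule dominated_convergence(2))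
      show "?g n integrable_on {s..t}" for n using g by blast
      show "(\<lambda>r. exp (m * r) * (B + \<bar>m\<bar>)) integrable_on {s..t}"
        by (intro integrable_continuous_real continuous_intros)
      show "norm (?g n r) \<le> exp (m * r) * (B + \<bar>m\<bar>)" if "r \<in> {s..t}" for n r
      proof -
        have r: "0 < r" using that s by auto
        have "\<bar>m * U n r\<bar> \<le> \<bar>m\<bar>" using mult_left_mono[OF U1[OF r, of n], of "\<bar>m\<bar>"] by (simp add: abs_mult)
        then have "\<bar>L n r + m * U n r\<bar> \<le> B + \<bar>m\<bar>" using LB[OF r, of n] by linarith
        then show ?thesis by (simp add: abs_mult)
      qed
      show "(\<lambda>n. ?g n r) \<longlonglongrightarrow> 0" if "r \<in> {s..t}" for r
      proof -
        have r: "0 < r" using that s by auto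
        have "(\<lambda>n. ?g n r) \<longlonglongrightarrow> exp (m * r) * (- m * f r + m * f r)"
          by (intro tendsto_intros Llim Ulim r)
        then show ?thesis by simp
      qed
    qed
    then have "(\<lambda>n. U n t * exp (m * t) - U n s * exp (m * s)) \<longlonglongrightarrow> 0"
      unfolding integral_unique[OF g] by simp
    moreover have "(\<lambda>n. U n t * exp (m * t) - U n s * exp (m * s)) \<longlonglongrightarrow> f t * exp (m * t) - f s * exp (m * s)"
      by (intro tendsto_intros Ulim) (use s in auto)
    ultimately show ?thesis using LIMSEQ_unique by fastforce
  qed
  \<comment> \<open>Near time \<open>0\<close> only \<open>\<bar>f\<bar> \<le> 1\<close> is needed, which is the bound on the mass.\<close>
  have "\<bar>f t\<bar> * exp (m * t) \<le> 1"
  proof (rule LIMSEQ_le_const)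
    have "(\<lambda>n. exp (m * (t / 2 * inverse (real (Suc n))))) \<longlonglongrightarrow> exp (m * (t / 2 * 0))"
      by (intro tendsto_intros LIMSEQ_inverse_real_of_nat)
    then show "(\<lambda>n. exp (m * (t / 2 * inverse (real (Suc n))))) \<longlonglongrightarrow> 1" by simp
    have "\<bar>f t\<bar> * exp (m * t) \<le> exp (m * (t / 2 * inverse (real (Suc n))))" for n
    proof -
      define s where "s = t / 2 * inverse (real (Suc n))"
      have "inverse (real (Suc n)) \<le> 1" by (simp add: inverse_le_1_iff)
      then have s: "0 < s" "s < t"
        using t mult_left_mono[of "inverse (real (Suc n))" 1 "t / 2"] by (auto simp: s_def)
      have "\<bar>f t\<bar> * exp (m * t) = \<bar>f s * exp (m * s)\<bar>"
        using arg_cong[OF const[OF s], of abs] by (simp add: abs_mult)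
      also have "\<dots> \<le> exp (m * s)"
        using f1[OF s(1)] by (simp add: abs_mult)
      finally show ?thesis by (simp add: s_def)
    qed
    then show "\<exists>N. \<forall>n\<ge>N. \<bar>f t\<bar> * exp (m * t) \<le> exp (m * (t / 2 * inverse (real (Suc n))))" by blast
  qed
  then have "\<bar>f t\<bar> \<le> exp (- (t * m))"
    by (simp add: exp_minus field_simps)
  then show ?thesis by (simp add: f_def m_def)
qed


section \<open>Gaussian averages of the heat kernel\<close>

lemma
  fixes f :: "'n::finite \<Rightarrow> real \<Rightarrow> 'b::{real_normed_field, banach, second_countable_topology}"
  assumes f: "\<And>i. integrable lborel (f i)"
  shows lborel_integrable_prod_vec: "integrable lborel (\<lambda>x::real ^ 'n. \<Prod>i\<in>UNIV. f i (x $ i))"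
    and lborel_integral_prod_vec: "integral\<^sup>L lborel (\<lambda>x::real ^ 'n. \<Prod>i\<in>UNIV. f i (x $ i)) = (\<Prod>i\<in>UNIV. LINT s|lborel. f i s)"
proof -
  interpret product_sigma_finite "\<lambda>_::real ^ 'n. lborel :: real measure" ..
  let ?P = "\<Pi>\<^sub>M b\<in>(Basis :: (real ^ 'n) set). (lborel :: real measure)"
  let ?T = "\<lambda>g. \<Sum>b\<in>(Basis :: (real ^ 'n) set). g b *\<^sub>R b"
  have fm [measurable]: "f i \<in> borel_measurable borel" for i
    using borel_measurable_integrable[OF f[of i]] by simp
  have Basis: "(Basis :: (real ^ 'n) set) = range (\<lambda>i. axis i 1)"
    by (auto simp: Basis_vec_def)
  have inj: "inj (\<lambda>i::'n. axis i (1::real))" by (auto simp: inj_def axis_eq_axis)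
  have F: "(\<Prod>i\<in>UNIV. f i (?T g $ i)) = (\<Prod>b\<in>Basis. f (axis_index b) (g b))" for g :: "real ^ 'n \<Rightarrow> real"
  proof -
    have "?T g $ i = g (axis i 1)" for i
    proof -
      have "?T g \<bullet> axis i 1 = g (axis i 1)"
        by (rule inner_sum_left_Basis) (simp add: axis_in_Basis_iff)
      then show ?thesis by (simp add: inner_axis)
    qed
    then show ?thesis unfolding Basis by (simp add: prod.reindex[OF inj] axis_index_axis)
  qed
  have m: "(\<lambda>x::real ^ 'n. \<Prod>i\<in>UNIV. f i (x $ i)) \<in> borel_measurable borel" by measurable
  have int: "integrable ?P (\<lambda>g. \<Prod>b\<in>Basis. f (axis_index b) (g b))"
    by (rule product_integrable_prod) (auto simp: f)
  have T: "?T \<in> measurable ?P borel" by measurable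
  show "integrable lborel (\<lambda>x::real ^ 'n. \<Prod>i\<in>UNIV. f i (x $ i))"
    unfolding lborel_eq[where 'a = "real ^ 'n"] integrable_distr_eq[OF T m] F by (rule int)
  have "integral\<^sup>L lborel (\<lambda>x::real ^ 'n. \<Prod>i\<in>UNIV. f i (x $ i)) = integral\<^sup>L ?P (\<lambda>g. \<Prod>b\<in>Basis. f (axis_index b) (g b))"
    unfolding lborel_eq[where 'a = "real ^ 'n"] integral_distr[OF T m] F ..
  also have "\<dots> = (\<Prod>b\<in>(Basis :: (real ^ 'n) set). LINT s|lborel. f (axis_index b) s)"
    by (rule product_integral_prod) (auto simp: f)
  also have "\<dots> = (\<Prod>i\<in>UNIV. LINT s|lborel. f i s)"
    unfolding Basis by (simp add: prod.reindex[OF inj] axis_index_axis)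
  finally show "integral\<^sup>L lborel (\<lambda>x::real ^ 'n. \<Prod>i\<in>UNIV. f i (x $ i)) = (\<Prod>i\<in>UNIV. LINT s|lborel. f i s)" .
qed

text \<open>The density of the standard Gaussian measure on \<open>\<real>\<^sup>N\<close>.\<close>

definition gauss_density :: "real ^ 'n::finite \<Rightarrow> real" where
  "gauss_density \<xi> = (\<Prod>i\<in>UNIV. std_normal_density (\<xi> $ i))"

lemma gauss_density_nonneg: "0 \<le> gauss_density \<xi>"
  unfolding gauss_density_def by (intro prod_nonneg) auto

lemma gauss_density_eq:
  "gauss_density (\<xi> :: real ^ 'n::finite) = (1 / sqrt (2 * pi)) ^ CARD('n) * exp (- (\<xi> \<bullet> \<xi>) / 2)"
proof -
  have "gauss_density \<xi> = (\<Prod>i\<in>(UNIV :: 'n set). 1 / sqrt (2 * pi)) * (\<Prod>i\<in>UNIV. exp (- (\<xi> $ i)\<^sup>2 / 2))"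
    unfolding gauss_density_def by (simp only: std_normal_density_def prod.distrib)
  also have "(\<Prod>i\<in>UNIV. exp (- (\<xi> $ i)\<^sup>2 / 2)) = exp (\<Sum>i\<in>UNIV. - (\<xi> $ i)\<^sup>2 / 2)"
    by (simp add: exp_sum)
  also have "(\<Sum>i\<in>UNIV. - (\<xi> $ i)\<^sup>2 / 2) = - (\<xi> \<bullet> \<xi>) / 2"
    by (simp add: inner_vec_def power2_eq_square sum_negf flip: sum_divide_distrib)
  finally show ?thesis by simp
qed

lemma measurable_gauss_density [measurable]: "gauss_density \<in> borel_measurable borel"
  unfolding gauss_density_def by measurable

lemma integrable_std_normal_density: "integrable lborel std_normal_density"
  using std_normal_moment_even[of 0] by (auto simp: has_bochner_integral_iff)

lemma integrable_gauss_density: "integrable lborel gauss_density"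
  unfolding gauss_density_def[abs_def] by (rule lborel_integrable_prod_vec) (rule integrable_std_normal_density)

lemma gauss_density_fourier:
  fixes z :: "real ^ 'n::finite"
  shows "(LINT \<xi>|lborel. gauss_density \<xi> * cos (\<xi> \<bullet> z)) = exp (- (z \<bullet> z) / 2)"
proof -
  define f :: "'n \<Rightarrow> real \<Rightarrow> complex" where "f i s = std_normal_density s *\<^sub>R iexp (z $ i * s)" for i s
  have f: "integrable lborel (f i)" for i
    by (rule Bochner_Integration.integrable_bound[OF integrable_std_normal_density])
       (auto simp: f_def[abs_def])
  have "(LINT s|lborel. f i s) = char std_normal_distribution (z $ i)" for i
    unfolding char_def f_def by (subst integral_density) auto
  then have "(LINT s|lborel. f i s) = of_real (exp (- (z $ i)\<^sup>2 / 2))" for i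
    by (simp add: char_std_normal_distribution)
  moreover have "(\<Prod>i\<in>UNIV. f i (\<xi> $ i)) = gauss_density \<xi> *\<^sub>R iexp (\<xi> \<bullet> z)" for \<xi>
  proof -
    have "(\<Prod>i\<in>UNIV. f i (\<xi> $ i)) = of_real (gauss_density \<xi>) * (\<Prod>i\<in>UNIV. iexp (z $ i * \<xi> $ i))"
      by (simp add: f_def gauss_density_def scaleR_conv_of_real flip: prod.distrib)
    also have "(\<Prod>i\<in>UNIV. iexp (z $ i * \<xi> $ i)) = exp (\<Sum>i\<in>UNIV. \<i> * of_real (z $ i * \<xi> $ i))"
      by (simp add: exp_sum)
    also have "(\<Sum>i\<in>UNIV. \<i> * of_real (z $ i * \<xi> $ i)) = \<i> * of_real (\<xi> \<bullet> z)"
      by (simp add: inner_vec_def sum_distrib_left mult.commute)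
    finally show ?thesis by (simp add: scaleR_conv_of_real)
  qed
  ultimately have int: "integrable lborel (\<lambda>\<xi>. gauss_density \<xi> *\<^sub>R iexp (\<xi> \<bullet> z))"
    and eq: "(LINT \<xi>|lborel. gauss_density \<xi> *\<^sub>R iexp (\<xi> \<bullet> z)) = (\<Prod>i\<in>UNIV. of_real (exp (- (z $ i)\<^sup>2 / 2)))"
    using lborel_integrable_prod_vec[where f = f, OF f] lborel_integral_prod_vec[where f = f, OF f] by simp_all
  have "(LINT \<xi>|lborel. gauss_density \<xi> * cos (\<xi> \<bullet> z)) = Re (LINT \<xi>|lborel. gauss_density \<xi> *\<^sub>R iexp (\<xi> \<bullet> z))"
    by (subst integral_Re[OF int, symmetric]) (simp add: Re_exp)
  also have "\<dots> = (\<Prod>i\<in>UNIV. exp (- (z $ i)\<^sup>2 / 2))"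
    unfolding eq by (simp flip: of_real_prod)
  also have "\<dots> = exp (- (z \<bullet> z) / 2)"
    by (simp add: inner_vec_def power2_eq_square sum_negf flip: exp_sum sum_divide_distrib)
  finally show ?thesis .
qed

lemma integral_gauss_density: "integral\<^sup>L lborel (gauss_density :: real ^ 'n::finite \<Rightarrow> real) = 1"
  using gauss_density_fourier[of "0 :: real ^ 'n"] by simp

text \<open>
  The right-hand side is \<open>K\<close> times the weight of \<open>integrable_levy_weight\<close> for exponent \<open>1\<close>. That
  weight vanishes at \<open>0\<close>, since \<open>0 powr a = 0\<close>, hence the condition \<open>s \<noteq> 0\<close>.
\<close>

lemma exp_minus_powr_le:
  fixes a c :: real
  assumes a: "0 < a" and c: "0 < c"
  obtains K where "\<And>s. s \<noteq> 0 \<Longrightarrow> exp (- (c * \<bar>s\<bar> powr a)) \<le> K * (\<bar>s\<bar> powr - 2 * min 1 (s\<^sup>2))"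
proof -
  obtain k :: nat where k: "2 / a \<le> real k" using real_arch_simple by blast
  have k0: "0 < k" using k a by (cases k) (auto simp: divide_le_0_iff)
  have ak: "2 \<le> a * real k" using k a by (simp add: field_simps)
  define K where "K = 1 + (real k / c) ^ k"
  have K: "1 \<le> K" using c by (simp add: K_def)
  have "exp (- (c * \<bar>s\<bar> powr a)) \<le> K * (\<bar>s\<bar> powr - 2 * min 1 (s\<^sup>2))" if s: "s \<noteq> 0" for s
  proof (cases "1 \<le> \<bar>s\<bar>")
    case True
    define u where "u = c * \<bar>s\<bar> powr a"
    have u: "0 < u" using s c by (simp add: u_def)
    have "(u / real k) ^ k \<le> (1 + u / real k) ^ k" using u by (intro power_mono) auto
    also have "\<dots> \<le> exp u" by (rule exp_ge_one_plus_x_over_n_power_n) (use u k0 in auto)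
    finally have "exp (- u) \<le> (real k / u) ^ k"
      using u k0 by (simp add: exp_minus power_divide field_simps)
    also have "\<dots> = (real k / c) ^ k * \<bar>s\<bar> powr - (a * real k)"
      using s by (simp add: u_def power_divide power_mult_distrib powr_minus powr_powr[symmetric] powr_realpow field_simps)
    also have "\<dots> \<le> K * \<bar>s\<bar> powr - 2"
      using True ak c by (intro mult_mono powr_mono) (auto simp: K_def)
    also have "\<dots> = K * (\<bar>s\<bar> powr - 2 * min 1 (s\<^sup>2))"
      using True by (simp add: abs_square_less_1 min_def abs_le_square_iff[of 1 s, simplified])
    finally show ?thesis by (simp add: u_def)
  next
    case False
    then have "s\<^sup>2 \<le> 1" by (simp add: abs_square_le_1)
    then have eq: "\<bar>s\<bar> powr - 2 * min 1 (s\<^sup>2) = 1"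
      using s by (simp add: powr_minus)
    have "exp (- (c * \<bar>s\<bar> powr a)) \<le> 1" using c by simp
    then show ?thesis unfolding eq using K by linarith
  qed
  then show thesis by (rule that)
qed

lemma integrable_exp_minus_powr:
  fixes a c :: real
  assumes a: "0 < a" and c: "0 < c"
  shows "integrable lborel (\<lambda>s. exp (- (c * \<bar>s\<bar> powr a)))"
proof -
  obtain K where K: "\<And>s. s \<noteq> 0 \<Longrightarrow> exp (- (c * \<bar>s\<bar> powr a)) \<le> K * (\<bar>s\<bar> powr - 2 * min 1 (s\<^sup>2))"
    using exp_minus_powr_le[OF a c] by blast
  show ?thesis
  proof (rule Bochner_Integration.integrable_bound)
    show "integrable lborel (\<lambda>s::real. K * (\<bar>s\<bar> powr - 2 * min 1 (s\<^sup>2)))"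
      using integrable_levy_weight[of 1] by simp
    show "AE s in lborel. norm (exp (- (c * \<bar>s\<bar> powr a))) \<le> norm (K * (\<bar>s\<bar> powr - 2 * min 1 (s\<^sup>2)))"
      using AE_lborel_singleton[of 0]
    proof eventually_elim
      case (elim s)
      from K[OF elim] abs_ge_self[of "K * (\<bar>s\<bar> powr - 2 * min 1 (s\<^sup>2))"] show ?case by simp
    qed
  qed measurable
qed

lemma integrable_std_normal_stable:
  fixes a c d t :: real
  assumes "0 \<le> c" "0 \<le> t"
  shows "integrable lborel (\<lambda>s. std_normal_density s * exp (- (t * (c * \<bar>s / d\<bar> powr a))))"
proof (rule Bochner_Integration.integrable_bound[OF integrable_std_normal_density])
  show "AE s in lborel. norm (std_normal_density s * exp (- (t * (c * \<bar>s / d\<bar> powr a)))) \<le> norm (std_normal_density s)"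
    using assms by (intro AE_I2) (simp add: abs_mult mult_left_le)
qed measurable

text \<open>
  The Gaussian factor is bounded by its maximum; the substitution \<open>s = d * t powr - (1 / a) * s'\<close>
  then shows how the remaining integral scales.
\<close>

lemma std_normal_stable_integral_le:
  fixes a c d t :: real
  assumes a: "0 < a" and c: "0 < c" and d: "0 < d" and t: "0 < t"
  shows "(LINT s|lborel. std_normal_density s * exp (- (t * (c * \<bar>s / d\<bar> powr a))))
     \<le> (1 / sqrt (2 * pi) * (LINT s|lborel. exp (- (c * \<bar>s\<bar> powr a)))) * (d * t powr - (1 / a))"
proof -
  define q where "q = d * t powr - (1 / a)"
  have q: "0 < q" using d t by (simp add: q_def)
  have scale: "exp (- (t * (c * \<bar>(0 + q * s) / d\<bar> powr a))) = exp (- (c * \<bar>s\<bar> powr a))" for s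
  proof -
    have "\<bar>(0 + q * s) / d\<bar> = t powr - (1 / a) * \<bar>s\<bar>"
      using d t by (simp add: q_def abs_mult)
    then have "t * \<bar>(0 + q * s) / d\<bar> powr a = t * (t powr - (1 / a)) powr a * \<bar>s\<bar> powr a"
      using t by (simp add: powr_mult)
    also have "(t powr - (1 / a)) powr a = t powr - 1"
      using a by (simp add: powr_powr)
    also have "t * t powr - 1 = 1"
      using t by (simp add: powr_minus)
    finally show ?thesis by (simp add: mult.left_commute)
  qed
  have int: "integrable lborel (\<lambda>s. exp (- (t * (c * \<bar>s / d\<bar> powr a))))"
  proof -
    have "integrable lborel (\<lambda>s. exp (- (t * (c * \<bar>(0 + q * s) / d\<bar> powr a))))"
      unfolding scale by (rule integrable_exp_minus_powr[OF a c])
    then show ?thesis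
      using lborel_integrable_real_affine_iff[of q "\<lambda>s. exp (- (t * (c * \<bar>s / d\<bar> powr a)))" 0] q by simp
  qed
  have "(LINT s|lborel. std_normal_density s * exp (- (t * (c * \<bar>s / d\<bar> powr a))))
     \<le> (LINT s|lborel. 1 / sqrt (2 * pi) * exp (- (t * (c * \<bar>s / d\<bar> powr a))))"
  proof (rule integral_mono)
    show "integrable lborel (\<lambda>s. std_normal_density s * exp (- (t * (c * \<bar>s / d\<bar> powr a))))"
      by (rule integrable_std_normal_stable) (use c t in auto)
    show "integrable lborel (\<lambda>s. 1 / sqrt (2 * pi) * exp (- (t * (c * \<bar>s / d\<bar> powr a))))"
      using int by (rule integrable_mult_right)
    show "std_normal_density s * exp (- (t * (c * \<bar>s / d\<bar> powr a))) \<le> 1 / sqrt (2 * pi) * exp (- (t * (c * \<bar>s / d\<bar> powr a)))" for s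
      by (intro mult_right_mono) (auto simp: std_normal_density_def intro!: divide_right_mono)
  qed
  also have "\<dots> = 1 / sqrt (2 * pi) * (LINT s|lborel. exp (- (t * (c * \<bar>s / d\<bar> powr a))))" by simp
  also have "(LINT s|lborel. exp (- (t * (c * \<bar>s / d\<bar> powr a)))) = q * (LINT s|lborel. exp (- (c * \<bar>s\<bar> powr a)))"
    using q by (subst lborel_integral_real_affine[of q _ 0]) (simp_all only: scale, simp_all)
  finally show ?thesis by (simp add: q_def mult_ac)
qed

text \<open>
  A Gaussian of width \<open>d\<close> is a superposition of the waves \<open>cos ((\<xi> / d) \<bullet> \<cdot>)\<close>. The factor \<open>d ^ N\<close>
  matches the volume of the region that it occupies, so this is an averaged form of
  \<open>H(\<cdot>, t) \<le> const * t powr - (\<Sum>i. 1 / \<alpha> i)\<close>.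
\<close>

lemma heat_kernel_gaussian_average:
  fixes H :: "real ^ 'n::finite \<Rightarrow> real \<Rightarrow> real"
  assumes C: "\<And>i. 0 < C i" and \<alpha>: "\<And>i. 0 < \<alpha> i" "\<And>i. \<alpha> i < 2"
    and hk: "is_heat_kernel (axis_levy_measure \<alpha> C) H"
  obtains K where "0 \<le> K" and
    "\<And>t d x. 0 < t \<Longrightarrow> 0 < d \<Longrightarrow>
      (LINT y|lborel. H y t * exp (- ((x - y) \<bullet> (x - y)) / (2 * d\<^sup>2)))
        \<le> K * t powr - (\<Sum>i\<in>UNIV. 1 / \<alpha> i) * d ^ CARD('n)"
proof -
  define c where "c i = C i / 2 * pi powr - \<alpha> i" for i
  have c: "0 < c i" for i using C[of i] by (simp add: c_def)
  define J where "J i = 1 / sqrt (2 * pi) * (LINT s|lborel. exp (- (c i * \<bar>s\<bar> powr \<alpha> i)))" for i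
  have J: "0 \<le> J i" for i unfolding J_def by (intro mult_nonneg_nonneg integral_nonneg) auto
  show thesis
  proof (rule that)
    show "0 \<le> (\<Prod>i\<in>UNIV. J i)" by (intro prod_nonneg J)
    fix t d :: real and x :: "real ^ 'n"
    assume t: "0 < t" and d: "0 < d"
    have h: "0 \<le> H y t" "integrable lborel (\<lambda>y. H y t)" "(LINT y|lborel. H y t) \<le> 1" for y
      using hk t unfolding is_heat_kernel_def by auto
    note borel_measurable_integrable[OF h(2), measurable]
    let ?F = "\<lambda>y \<xi>. H y t * (gauss_density \<xi> * cos ((\<xi> /\<^sub>R d) \<bullet> (x - y)))"
    have gauss: "exp (- ((x - y) \<bullet> (x - y)) / (2 * d\<^sup>2)) = (LINT \<xi>|lborel. gauss_density \<xi> * cos ((\<xi> /\<^sub>R d) \<bullet> (x - y)))" for y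
    proof -
      have "- ((w /\<^sub>R d) \<bullet> (w /\<^sub>R d)) / 2 = - (w \<bullet> w) / (2 * d\<^sup>2)" for w :: "real ^ 'n"
        using d by (simp add: power2_eq_square field_simps)
      moreover have "\<xi> \<bullet> (w /\<^sub>R d) = (\<xi> /\<^sub>R d) \<bullet> w" for \<xi> w :: "real ^ 'n" by simp
      ultimately show ?thesis using gauss_density_fourier[of "(x - y) /\<^sub>R d"] by (simp only:)
    qed
    have Fint: "integrable (lborel \<Otimes>\<^sub>M lborel) (\<lambda>(y, \<xi>). ?F y \<xi>)"
    proof (rule Bochner_Integration.integrable_bound)
      show "integrable (lborel \<Otimes>\<^sub>M lborel) (\<lambda>(y, \<xi>::real ^ 'n). H y t * gauss_density \<xi>)"
      proof (rule lborel_pair.Fubini_integrable)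
        show "integrable lborel (\<lambda>y. LINT \<xi>|lborel. norm (case (y, \<xi>::real ^ 'n) of (y, \<xi>) \<Rightarrow> H y t * gauss_density \<xi>))"
          using h by (simp add: abs_mult gauss_density_nonneg integral_gauss_density)
        show "AE y in lborel. integrable lborel (\<lambda>\<xi>. case (y, \<xi>::real ^ 'n) of (y, \<xi>) \<Rightarrow> H y t * gauss_density \<xi>)"
          by (simp add: integrable_gauss_density)
      qed measurable
      show "AE p in lborel \<Otimes>\<^sub>M lborel. norm (case p of (y, \<xi>) \<Rightarrow> ?F y \<xi>) \<le> norm (case p of (y, \<xi>) \<Rightarrow> H y t * gauss_density \<xi>)"
        using h(1) by (intro AE_I2) (auto simp: abs_mult gauss_density_nonneg intro!: mult_left_mono mult_left_le)
    qed measurable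
    have "(LINT y|lborel. H y t * exp (- ((x - y) \<bullet> (x - y)) / (2 * d\<^sup>2))) = (LINT y|lborel. LINT \<xi>|lborel. ?F y \<xi>)"
      unfolding gauss by simp
    also have "\<dots> = (LINT \<xi>|lborel. LINT y|lborel. ?F y \<xi>)"
      by (rule lborel_pair.Fubini_integral[OF Fint, symmetric])
    also have "\<dots> = (LINT \<xi>|lborel. gauss_density \<xi> * (LINT y|lborel. H y t * cos ((\<xi> /\<^sub>R d) \<bullet> (x - y))))"
      by (simp add: mult.left_commute[of "H _ t"])
    also have "\<dots> \<le> (LINT \<xi>|lborel. (\<Prod>i\<in>UNIV. std_normal_density (\<xi> $ i) * exp (- (t * (c i * \<bar>\<xi> $ i / d\<bar> powr \<alpha> i)))))"
    proof (rule integral_mono)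
      show "integrable lborel (\<lambda>\<xi>. gauss_density \<xi> * (LINT y|lborel. H y t * cos ((\<xi> /\<^sub>R d) \<bullet> (x - y))))"
        using lborel_pair.integrable_snd[OF Fint] by (simp add: mult.left_commute[of "H _ t"])
      show "integrable lborel (\<lambda>\<xi>::real ^ 'n. \<Prod>i\<in>UNIV. std_normal_density (\<xi> $ i) * exp (- (t * (c i * \<bar>\<xi> $ i / d\<bar> powr \<alpha> i))))"
        by (intro lborel_integrable_prod_vec integrable_std_normal_stable less_imp_le c t)
      fix \<xi> :: "real ^ 'n"
      have "(\<Sum>i\<in>UNIV. c i * \<bar>(\<xi> /\<^sub>R d) $ i\<bar> powr \<alpha> i) \<le> levy_symbol \<alpha> C (\<xi> /\<^sub>R d)"
        unfolding levy_symbol_def c_def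
        by (intro sum_mono levy_symbol_1D_lower \<alpha> less_imp_le[OF C])
      then have "(\<Sum>i\<in>UNIV. c i * \<bar>\<xi> $ i / d\<bar> powr \<alpha> i) \<le> levy_symbol \<alpha> C (\<xi> /\<^sub>R d)"
        by (simp add: divide_inverse mult.commute)
      then have "exp (- (t * levy_symbol \<alpha> C (\<xi> /\<^sub>R d))) \<le> exp (- (t * (\<Sum>i\<in>UNIV. c i * \<bar>\<xi> $ i / d\<bar> powr \<alpha> i)))"
        using t by simp
      also have "\<dots> = (\<Prod>i\<in>UNIV. exp (- (t * (c i * \<bar>\<xi> $ i / d\<bar> powr \<alpha> i))))"
        by (simp add: sum_distrib_left flip: exp_sum sum_negf)
      finally have "exp (- (t * levy_symbol \<alpha> C (\<xi> /\<^sub>R d))) \<le> \<dots>" .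
      moreover have "(LINT y|lborel. H y t * cos ((\<xi> /\<^sub>R d) \<bullet> (x - y))) \<le> exp (- (t * levy_symbol \<alpha> C (\<xi> /\<^sub>R d)))"
        using heat_kernel_fourier_decay[OF less_imp_le[OF C] \<alpha> hk t, of "\<xi> /\<^sub>R d" x] by linarith
      ultimately have "(LINT y|lborel. H y t * cos ((\<xi> /\<^sub>R d) \<bullet> (x - y))) \<le> (\<Prod>i\<in>UNIV. exp (- (t * (c i * \<bar>\<xi> $ i / d\<bar> powr \<alpha> i))))"
        by linarith
      from mult_left_mono[OF this gauss_density_nonneg]
      show "gauss_density \<xi> * (LINT y|lborel. H y t * cos ((\<xi> /\<^sub>R d) \<bullet> (x - y)))
          \<le> (\<Prod>i\<in>UNIV. std_normal_density (\<xi> $ i) * exp (- (t * (c i * \<bar>\<xi> $ i / d\<bar> powr \<alpha> i))))"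
        by (simp add: gauss_density_def prod.distrib)
    qed
    also have "\<dots> = (\<Prod>i\<in>UNIV. LINT s|lborel. std_normal_density s * exp (- (t * (c i * \<bar>s / d\<bar> powr \<alpha> i))))"
      by (intro lborel_integral_prod_vec integrable_std_normal_stable less_imp_le c t)
    also have "\<dots> \<le> (\<Prod>i\<in>UNIV. J i * (d * t powr - (1 / \<alpha> i)))"
      unfolding J_def
      by (intro prod_mono conjI std_normal_stable_integral_le \<alpha> c d t integral_nonneg) auto
    also have "\<dots> = (\<Prod>i\<in>UNIV. J i) * (d ^ CARD('n) * t powr (\<Sum>i\<in>UNIV. - (1 / \<alpha> i)))"
      using t by (simp add: prod.distrib powr_sum)
    finally show "(LINT y|lborel. H y t * exp (- ((x - y) \<bullet> (x - y)) / (2 * d\<^sup>2)))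
        \<le> (\<Prod>i\<in>UNIV. J i) * t powr - (\<Sum>i\<in>UNIV. 1 / \<alpha> i) * d ^ CARD('n)"
      by (simp add: sum_negf mult_ac)
  qed
qed


section \<open>From Gaussian averages to a pointwise bound\<close>

lemma AE_le_of_emeasure_open_le:
  fixes h :: "'a::euclidean_space \<Rightarrow> real"
  assumes [measurable]: "h \<in> borel_measurable borel" and h: "\<And>y. 0 \<le> h y" and B: "0 \<le> B"
    and le: "\<And>U. open U \<Longrightarrow> (\<integral>\<^sup>+ y. ennreal (h y) * indicator U y \<partial>lborel) \<le> ennreal B * emeasure lborel U"
  shows "AE y in lborel. h y \<le> B"
proof -
  have "AE y in lborel. \<not> (y \<in> ball 0 (real n) \<and> B < h y)" for n :: nat
  proof -
    define A where "A = {y \<in> ball 0 (real n). B < h y}"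
    have A [measurable]: "A \<in> sets borel" unfolding A_def by measurable
    have "emeasure lborel A \<le> emeasure lborel (ball 0 (real n) :: 'a set)"
      by (rule emeasure_mono) (auto simp: A_def)
    then have Afin: "emeasure lborel A < \<infinity>"
      using emeasure_lborel_ball_finite by (rule le_less_trans)
    have ineq: "(\<integral>\<^sup>+ y. ennreal (h y) * indicator A y \<partial>lborel) \<le> ennreal B * emeasure lborel A"
    proof (rule ennreal_le_epsilon)
      fix e :: real assume e: "0 < e"
      obtain U where U: "open U" "A \<subseteq> U" "emeasure lborel (U - A) < ennreal (e / (B + 1))"
        using outer_regular_lborel[OF A, of "e / (B + 1)"] e B by auto
      have [measurable]: "U \<in> sets borel" using U by auto
      have "(\<integral>\<^sup>+ y. ennreal (h y) * indicator A y \<partial>lborel) \<le> (\<integral>\<^sup>+ y. ennreal (h y) * indicator U y \<partial>lborel)"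
        using U by (intro nn_integral_mono) (auto simp: indicator_def)
      also have "\<dots> \<le> ennreal B * emeasure lborel U" by (rule le[OF U(1)])
      also have "emeasure lborel U = emeasure lborel A + emeasure lborel (U - A)"
        using U by (subst plus_emeasure) (auto intro!: arg_cong[where f = "emeasure lborel"])
      also have "ennreal B * (emeasure lborel A + emeasure lborel (U - A))
         \<le> ennreal B * (emeasure lborel A + ennreal (e / (B + 1)))"
        using U by (intro mult_left_mono add_left_mono) auto
      also have "\<dots> = ennreal B * emeasure lborel A + ennreal (B * (e / (B + 1)))"
        using B e by (subst ennreal_mult) (auto simp: distrib_left)
      also have "\<dots> \<le> ennreal B * emeasure lborel A + ennreal e"
        using B e by (intro add_left_mono ennreal_leI) (simp add: field_simps)
      finally show "(\<integral>\<^sup>+ y. ennreal (h y) * indicator A y \<partial>lborel) \<le> ennreal B * emeasure lborel A + ennreal e" .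
    qed
    have "(\<integral>\<^sup>+ y. ennreal (h y) * indicator A y \<partial>lborel)
       = (\<integral>\<^sup>+ y. ennreal B * indicator A y + ennreal (h y - B) * indicator A y \<partial>lborel)"
    proof (intro nn_integral_cong)
      fix y
      show "ennreal (h y) * indicator A y = ennreal B * indicator A y + ennreal (h y - B) * indicator A y"
        using B by (cases "y \<in> A") (auto simp: A_def simp flip: ennreal_plus)
    qed
    also have "\<dots> = ennreal B * emeasure lborel A + (\<integral>\<^sup>+ y. ennreal (h y - B) * indicator A y \<partial>lborel)"
      by (subst nn_integral_add) (auto simp: nn_integral_cmult)
    finally have "ennreal B * emeasure lborel A + (\<integral>\<^sup>+ y. ennreal (h y - B) * indicator A y \<partial>lborel)
       \<le> ennreal B * emeasure lborel A + 0"
      using ineq by simp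
    moreover have "ennreal B * emeasure lborel A \<noteq> \<top>"
      using Afin by (auto simp: ennreal_mult_eq_top_iff)
    ultimately have "(\<integral>\<^sup>+ y. ennreal (h y - B) * indicator A y \<partial>lborel) = 0"
      by (simp only: ennreal_add_left_cancel_le) simp
    then have "AE y in lborel. ennreal (h y - B) * indicator A y = 0"
      by (subst (asm) nn_integral_0_iff_AE) auto
    then show ?thesis
      by eventually_elim (auto simp: A_def indicator_def ennreal_eq_0_iff split: if_splits)
  qed
  then have "AE y in lborel. \<forall>n::nat. \<not> (y \<in> ball 0 (real n) \<and> B < h y)"
    by (subst AE_all_countable) auto
  then show ?thesis
  proof eventually_elim
    case (elim y)
    obtain n where "norm y < real n" using reals_Archimedean2 by blast
    with elim[rule_format, of n] show ?case by auto
  qed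
qed

lemma nn_integral_gauss_density: "(\<integral>\<^sup>+ \<xi>. ennreal (gauss_density (\<xi> :: real ^ 'n::finite)) \<partial>lborel) = 1"
  by (subst nn_integral_eq_integral)
     (auto simp: integrable_gauss_density integral_gauss_density gauss_density_nonneg)

text \<open>
  Open sets are approximated from below by Gaussian smoothings of their indicators, in the
  sense needed for Fatou's lemma.
\<close>

lemma AE_le_of_gaussian_averages:
  fixes h :: "real ^ 'n::finite \<Rightarrow> real"
  assumes h: "\<And>y. 0 \<le> h y" "integrable lborel h" and A: "0 \<le> A"
    and avg: "\<And>d x. 0 < d \<Longrightarrow>
      (LINT y|lborel. h y * exp (- ((x - y) \<bullet> (x - y)) / (2 * d\<^sup>2))) \<le> A * d ^ CARD('n)"
  shows "AE y in lborel. h y \<le> A * (1 / sqrt (2 * pi)) ^ CARD('n)"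
proof (rule AE_le_of_emeasure_open_le[OF _ h(1)])
  let ?g = "gauss_density :: real ^ 'n \<Rightarrow> real"
  define B where "B = A * (1 / sqrt (2 * pi)) ^ CARD('n)"
  show hm [measurable]: "h \<in> borel_measurable borel"
    using borel_measurable_integrable[OF h(2)] by simp
  show "0 \<le> A * (1 / sqrt (2 * pi)) ^ CARD('n)" using A by simp
  have smooth: "(\<integral>\<^sup>+ y. ennreal (h y * ?g ((1 / d) *\<^sub>R (y - w))) \<partial>lborel) \<le> ennreal (B * d ^ CARD('n))"
    if d: "0 < d" for d w
  proof -
    have g: "?g ((1 / d) *\<^sub>R (y - w)) = (1 / sqrt (2 * pi)) ^ CARD('n) * exp (- ((w - y) \<bullet> (w - y)) / (2 * d\<^sup>2))" for y
    proof -
      have "- (((1 / d) *\<^sub>R v) \<bullet> ((1 / d) *\<^sub>R v)) / 2 = - (v \<bullet> v) / (2 * d\<^sup>2)" for v :: "real ^ 'n"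
        by (simp add: power2_eq_square)
      moreover have "(y - w) \<bullet> (y - w) = (w - y) \<bullet> (w - y)"
        by (simp add: inner_diff_left inner_diff_right inner_commute)
      ultimately show ?thesis unfolding gauss_density_eq by (simp only:)
    qed
    have int: "integrable lborel (\<lambda>y. h y * exp (- ((w - y) \<bullet> (w - y)) / (2 * d\<^sup>2)))"
      by (rule Bochner_Integration.integrable_bound[OF h(2)])
         (auto simp: abs_mult h(1) intro!: mult_left_le)
    have "(\<integral>\<^sup>+ y. ennreal (h y * ?g ((1 / d) *\<^sub>R (y - w))) \<partial>lborel)
       = (\<integral>\<^sup>+ y. ennreal ((1 / sqrt (2 * pi)) ^ CARD('n) * (h y * exp (- ((w - y) \<bullet> (w - y)) / (2 * d\<^sup>2)))) \<partial>lborel)"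
      unfolding g by (simp add: mult_ac)
    also have "\<dots> = ennreal ((1 / sqrt (2 * pi)) ^ CARD('n) * (LINT y|lborel. h y * exp (- ((w - y) \<bullet> (w - y)) / (2 * d\<^sup>2))))"
      by (subst nn_integral_eq_integral) (use int h(1) in auto)
    also have "\<dots> \<le> ennreal ((1 / sqrt (2 * pi)) ^ CARD('n) * (A * d ^ CARD('n)))"
      by (intro ennreal_leI mult_left_mono avg d) auto
    finally show ?thesis by (simp add: B_def mult_ac)
  qed
  fix U :: "(real ^ 'n) set" assume U: "open U"
  have [measurable]: "U \<in> sets borel" using U by auto
  define e where "e n = inverse (real (Suc n))" for n
  have e: "0 < e n" for n by (simp add: e_def)
  let ?I = "\<lambda>n y z. ennreal (h y) * (ennreal (?g z) * indicator U (y - e n *\<^sub>R z))"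
  have low: "ennreal (h y) * indicator U y * ennreal (?g z) \<le> liminf (\<lambda>n. ?I n y z)" for y z
  proof (cases "y \<in> U")
    case True
    have "(\<lambda>n. y - e n *\<^sub>R z) \<longlonglongrightarrow> y - 0 *\<^sub>R z"
      unfolding e_def by (intro tendsto_intros LIMSEQ_inverse_real_of_nat)
    then have "\<forall>\<^sub>F n in sequentially. y - e n *\<^sub>R z \<in> U"
      using U True by (intro topological_tendstoD[of _ y]) auto
    then have "\<forall>\<^sub>F n in sequentially. ennreal (h y) * indicator U y * ennreal (?g z) \<le> ?I n y z"
      by eventually_elim (simp add: True)
    then show ?thesis by (rule Liminf_bounded)
  qed simp
  have step: "(\<integral>\<^sup>+ y. \<integral>\<^sup>+ z. ?I n y z \<partial>lborel \<partial>lborel) \<le> ennreal B * emeasure lborel U" for n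
  proof -
    let ?d = "e n"
    \<comment> \<open>Substitute \<open>w = y - e n *\<^sub>R z\<close>.\<close>
    have sub: "(\<integral>\<^sup>+ z. ennreal (?g z) * indicator U (y - ?d *\<^sub>R z) \<partial>lborel)
      = (\<integral>\<^sup>+ w. ennreal (?g ((1 / ?d) *\<^sub>R (y - w)) / ?d ^ CARD('n)) * indicator U w \<partial>lborel)" (is "_ = ?R") for y
    proof -
      have "?R = (\<integral>\<^sup>+ w. ennreal (?g ((1 / ?d) *\<^sub>R (y - w)) / ?d ^ CARD('n)) * indicator U w
          \<partial>density (distr lborel borel (\<lambda>x. y + (- ?d) *\<^sub>R x)) (\<lambda>_. ennreal (\<bar>- ?d\<bar> ^ DIM(real ^ 'n))))"
        using e[of n] by (subst lborel_affine[of "- ?d" y]) auto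
      also have "\<dots> = (\<integral>\<^sup>+ z. ennreal (?d ^ CARD('n)) * (ennreal (?g z / ?d ^ CARD('n)) * indicator U (y - ?d *\<^sub>R z)) \<partial>lborel)"
        using e[of n] by (simp add: nn_integral_density nn_integral_distr)
      also have "\<dots> = (\<integral>\<^sup>+ z. ennreal (?g z) * indicator U (y - ?d *\<^sub>R z) \<partial>lborel)"
        using e[of n] by (intro nn_integral_cong)
          (simp add: gauss_density_nonneg flip: mult.assoc ennreal_mult)
      finally show ?thesis ..
    qed
    have "(\<integral>\<^sup>+ y. \<integral>\<^sup>+ z. ?I n y z \<partial>lborel \<partial>lborel)
      = (\<integral>\<^sup>+ y. \<integral>\<^sup>+ w. ennreal (h y) * (ennreal (?g ((1 / ?d) *\<^sub>R (y - w)) / ?d ^ CARD('n)) * indicator U w) \<partial>lborel \<partial>lborel)"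
      by (simp add: nn_integral_cmult sub)
    also have "\<dots> = (\<integral>\<^sup>+ w. \<integral>\<^sup>+ y. ennreal (h y) * (ennreal (?g ((1 / ?d) *\<^sub>R (y - w)) / ?d ^ CARD('n)) * indicator U w) \<partial>lborel \<partial>lborel)"
      by (rule lborel_pair.Fubini'[symmetric]) measurable
    also have "\<dots> \<le> (\<integral>\<^sup>+ w. ennreal B * indicator U w \<partial>lborel)"
    proof (rule nn_integral_mono)
      fix w
      have "(\<integral>\<^sup>+ y. ennreal (h y) * (ennreal (?g ((1 / ?d) *\<^sub>R (y - w)) / ?d ^ CARD('n)) * indicator U w) \<partial>lborel)
        = (\<integral>\<^sup>+ y. ennreal (1 / ?d ^ CARD('n)) * indicator U w * ennreal (h y * ?g ((1 / ?d) *\<^sub>R (y - w))) \<partial>lborel)"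
      proof (rule nn_integral_cong)
        fix y
        have "ennreal (h y) * ennreal (?g ((1 / ?d) *\<^sub>R (y - w)) / ?d ^ CARD('n))
            = ennreal (1 / ?d ^ CARD('n)) * ennreal (h y * ?g ((1 / ?d) *\<^sub>R (y - w)))"
          using e[of n] h(1) by (simp add: gauss_density_nonneg flip: ennreal_mult)
        then show "ennreal (h y) * (ennreal (?g ((1 / ?d) *\<^sub>R (y - w)) / ?d ^ CARD('n)) * indicator U w)
          = ennreal (1 / ?d ^ CARD('n)) * indicator U w * ennreal (h y * ?g ((1 / ?d) *\<^sub>R (y - w)))"
          by (simp add: indicator_def)
      qed
      also have "\<dots> = ennreal (1 / ?d ^ CARD('n)) * indicator U w * (\<integral>\<^sup>+ y. ennreal (h y * ?g ((1 / ?d) *\<^sub>R (y - w))) \<partial>lborel)"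
        by (rule nn_integral_cmult) measurable
      also have "\<dots> \<le> ennreal (1 / ?d ^ CARD('n)) * indicator U w * ennreal (B * ?d ^ CARD('n))"
        by (intro mult_left_mono smooth e) auto
      also have "\<dots> = ennreal B * indicator U w"
      proof -
        have "ennreal (1 / ?d ^ CARD('n)) * ennreal (B * ?d ^ CARD('n)) = ennreal B"
          using e[of n] A by (simp add: B_def flip: ennreal_mult)
        then show ?thesis by (simp add: indicator_def)
      qed
      finally show "(\<integral>\<^sup>+ y. ennreal (h y) * (ennreal (?g ((1 / ?d) *\<^sub>R (y - w)) / ?d ^ CARD('n)) * indicator U w) \<partial>lborel)
        \<le> ennreal B * indicator U w" .
    qed
    also have "\<dots> = ennreal B * emeasure lborel U" by (simp add: nn_integral_cmult)
    finally show ?thesis .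
  qed
  have "(\<integral>\<^sup>+ y. ennreal (h y) * indicator U y \<partial>lborel)
      = (\<integral>\<^sup>+ y. \<integral>\<^sup>+ z. ennreal (h y) * indicator U y * ennreal (?g z) \<partial>lborel \<partial>lborel)"
    by (simp add: nn_integral_cmult nn_integral_gauss_density)
  also have "\<dots> \<le> (\<integral>\<^sup>+ y. \<integral>\<^sup>+ z. liminf (\<lambda>n. ?I n y z) \<partial>lborel \<partial>lborel)"
    by (intro nn_integral_mono low)
  also have "\<dots> \<le> (\<integral>\<^sup>+ y. liminf (\<lambda>n. \<integral>\<^sup>+ z. ?I n y z \<partial>lborel) \<partial>lborel)"
    by (intro nn_integral_mono nn_integral_liminf) measurable
  also have "\<dots> \<le> liminf (\<lambda>n. \<integral>\<^sup>+ y. \<integral>\<^sup>+ z. ?I n y z \<partial>lborel \<partial>lborel)"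
    by (intro nn_integral_liminf) measurable
  also have "\<dots> \<le> liminf (\<lambda>n. ennreal B * emeasure lborel U)"
    by (intro Liminf_mono always_eventually allI step)
  finally show "(\<integral>\<^sup>+ y. ennreal (h y) * indicator U y \<partial>lborel)
      \<le> ennreal (A * (1 / sqrt (2 * pi)) ^ CARD('n)) * emeasure lborel U"
    by (simp add: B_def Liminf_const)
qed


section \<open>Integrability of the Green function\<close>

text \<open>The tangent line to \<open>b \<mapsto> b powr p\<close> at \<open>a\<close>, rearranged so that no term is subtracted.\<close>

lemma powr_tangent_line:
  fixes a b p :: real
  assumes p: "1 < p" and a: "0 \<le> a" and b: "0 \<le> b"
  shows "p * a powr (p - 1) * b \<le> b powr p + (p - 1) * a powr p"
proof -
  have "b * a powr (p - 1) \<le> b powr p / p + (a powr (p - 1)) powr (p / (p - 1)) / (p / (p - 1))"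
    by (rule Youngs_inequality) (use p a b in \<open>auto simp: field_simps\<close>)
  also have "(a powr (p - 1)) powr (p / (p - 1)) = a powr p" using p by (simp add: powr_powr)
  finally have "p * (b * a powr (p - 1)) \<le> p * (b powr p / p + a powr p / (p / (p - 1)))"
    using p by (intro mult_left_mono) auto
  also have "\<dots> = b powr p + (p - 1) * a powr p" using p by (simp add: field_simps)
  finally show ?thesis by (simp add: mult_ac)
qed

text \<open>Jensen's inequality for the probability density \<open>exp (- t)\<close> on the half line.\<close>

lemma nn_integral_exp_minus: "(\<integral>\<^sup>+ t. ennreal (indicator {0<..} t * exp (- t)) \<partial>lborel) = 1"
proof -
  have "(\<integral>\<^sup>+ t. ennreal (indicator {0<..} t * exp (- t)) \<partial>lborel)
     = (\<integral>\<^sup>+ t. ennreal (indicator {0..} t * t powr (1 - 1) / exp t) \<partial>lborel)"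
    by (intro nn_integral_cong_AE, use AE_lborel_singleton[of 0] in eventually_elim)
       (auto simp: indicator_def exp_minus divide_inverse)
  also have "\<dots> = 1" by (subst Gamma_conv_nn_integral_real[symmetric]) auto
  finally show ?thesis .
qed

lemma exp_weighted_jensen:
  fixes f :: "real \<Rightarrow> real"
  assumes [measurable]: "f \<in> borel_measurable borel" and f: "\<And>t. 0 \<le> f t" and p: "1 < p"
  shows "ennreal_powr (\<integral>\<^sup>+ t. ennreal (indicator {0<..} t * exp (- t) * f t) \<partial>lborel) p
     \<le> (\<integral>\<^sup>+ t. ennreal (indicator {0<..} t * exp (- t) * f t powr p) \<partial>lborel)"
proof -
  let ?w = "\<lambda>t::real. indicator {0<..} t * exp (- t)"
  define I where "I = (\<integral>\<^sup>+ t. ennreal (?w t * f t) \<partial>lborel)"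
  define J where "J = (\<integral>\<^sup>+ t. ennreal (?w t * f t powr p) \<partial>lborel)"
  have w: "0 \<le> ?w t" for t by simp
  have key: "ennreal (p * a powr (p - 1)) * I \<le> J + ennreal ((p - 1) * a powr p)" if a: "0 \<le> a" for a
  proof -
    have "ennreal (p * a powr (p - 1)) * I = (\<integral>\<^sup>+ t. ennreal (?w t * (p * a powr (p - 1) * f t)) \<partial>lborel)"
      unfolding I_def
      by (subst nn_integral_cmult[symmetric])
         (use p f in \<open>auto simp: mult_ac simp flip: ennreal_mult intro!: nn_integral_cong\<close>)
    also have "\<dots> \<le> (\<integral>\<^sup>+ t. ennreal (?w t * f t powr p) + ennreal ((p - 1) * a powr p) * ennreal (?w t) \<partial>lborel)"
    proof (rule nn_integral_mono)
      fix t
      have "?w t * (p * a powr (p - 1) * f t) \<le> ?w t * (f t powr p + (p - 1) * a powr p)"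
        by (intro mult_left_mono powr_tangent_line p a f w)
      then have "ennreal (?w t * (p * a powr (p - 1) * f t)) \<le> ennreal (?w t * f t powr p + (p - 1) * a powr p * ?w t)"
        by (intro ennreal_leI) (simp add: algebra_simps)
      also have "\<dots> = ennreal (?w t * f t powr p) + ennreal ((p - 1) * a powr p) * ennreal (?w t)"
        using p by (simp add: ennreal_plus ennreal_mult)
      finally show "ennreal (?w t * (p * a powr (p - 1) * f t)) \<le> \<dots>" .
    qed
    also have "\<dots> = J + ennreal ((p - 1) * a powr p) * 1"
      unfolding J_def by (subst nn_integral_add) (auto simp: nn_integral_cmult nn_integral_exp_minus)
    finally show ?thesis by simp
  qed
  have "ennreal_powr I p \<le> J"
  proof (cases "I = \<top>")
    case True
    then have "J + ennreal ((p - 1) * 1 powr p) = \<top>"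
      using key[of 1] p by (simp add: ennreal_mult_top top_unique)
    then have "J = \<top>" by (simp add: ennreal_add_eq_top)
    then show ?thesis by simp
  next
    case False
    then obtain a where a: "I = ennreal a" "0 \<le> a" by (cases I) auto
    have "ennreal (p * a powr (p - 1)) * I = ennreal (p * a powr (p - 1) * a)"
      using a p by (simp add: ennreal_mult)
    also have "p * a powr (p - 1) * a = (p - 1) * a powr p + a powr p"
    proof (cases "a = 0")
      case False
      then have "a powr (p - 1) * a = a powr p" using a by (simp add: powr_diff)
      then show ?thesis by (simp add: algebra_simps)
    qed simp
    also have "ennreal \<dots> = ennreal ((p - 1) * a powr p) + ennreal (a powr p)"
      using p by (simp add: ennreal_plus)
    finally have "ennreal ((p - 1) * a powr p) + ennreal (a powr p) \<le> ennreal ((p - 1) * a powr p) + J"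
      using key[OF a(2)] by (simp add: add.commute)
    then have "ennreal (a powr p) \<le> J" by (simp add: ennreal_add_left_cancel_le)
    then show ?thesis using a by (simp add: ennreal_powr_def)
  qed
  then show ?thesis by (simp add: I_def J_def)
qed

lemma measurable_ennreal_powr [measurable]: "(\<lambda>a. ennreal_powr a p) \<in> borel_measurable borel"
  unfolding ennreal_powr_def by measurable

lemma nn_integral_lborel_translate:
  fixes g :: "'a::euclidean_space \<Rightarrow> ennreal"
  assumes [measurable]: "g \<in> borel_measurable borel"
  shows "(\<integral>\<^sup>+ x. g (x - x0) \<partial>lborel) = (\<integral>\<^sup>+ x. g x \<partial>lborel)"
proof -
  have "(\<integral>\<^sup>+ x. g x \<partial>lborel) = (\<integral>\<^sup>+ x. g x \<partial>distr lborel borel ((+) (- x0)))"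
    by (simp add: lborel_distr_plus)
  also have "\<dots> = (\<integral>\<^sup>+ x. g (- x0 + x) \<partial>lborel)" by (rule nn_integral_distr) auto
  finally show ?thesis by simp
qed

theorem lemma7p24:
  fixes \<alpha> C :: "'n::finite \<Rightarrow> real"
    and H :: "real ^ 'n \<Rightarrow> real \<Rightarrow> real"
  assumes "CARD('n) \<ge> 3"
    and "\<And>i. 0 < \<alpha> i" and "\<And>i. \<alpha> i < 2"
    and "(\<Sum>i\<in>UNIV. 1 / \<alpha> i) > 1"
    and "\<And>i. 0 < C i"
    and "is_heat_kernel (axis_levy_measure \<alpha> C) H"
  shows "\<exists>p\<in>{1<..<(\<Sum>i\<in>UNIV. 1 / \<alpha> i) / ((\<Sum>i\<in>UNIV. 1 / \<alpha> i) - 1)}. \<exists>C\<^sub>p :: real. \<forall>x0.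
           Lp_norm p (resolvent_green H x0) = Lp_norm p (resolvent_green H 0) \<and>
           Lp_norm p (resolvent_green H 0) \<le> ennreal C\<^sub>p"
proof -
  define S where "S = (\<Sum>i\<in>UNIV. 1 / \<alpha> i)"
  have S: "1 < S" using assms(4) by (simp add: S_def)
  \<comment> \<open>Any exponent with \<open>(p - 1) * S < 1\<close> would do; this one makes the time integral \<open>Gamma (1 / 2)\<close>.\<close>
  define p where "p = 1 + 1 / (2 * S)"
  have p: "1 < p" "p < S / (S - 1)"
    using S by (auto simp: p_def field_simps)
  have pS: "S * (p - 1) = 1 / 2" using S by (simp add: p_def)
  \<comment> \<open>\<open>H\<close> is only known to be measurable for positive times.\<close>
  define h where "h x t = indicator {0<..} t * H x t" for x t
  have hm: "(\<lambda>(x, t). h x t) \<in> borel_measurable (borel \<Otimes>\<^sub>M borel)"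
  proof -
    have "(\<lambda>q. indicator (UNIV \<times> {0<..}) q *\<^sub>R (case q of (x, t) \<Rightarrow> H x t)) \<in> borel_measurable borel"
      using assms(6) unfolding is_heat_kernel_def set_borel_measurable_def by simp
    also have "(\<lambda>q. indicator (UNIV \<times> {0<..}) q *\<^sub>R (case q of (x, t) \<Rightarrow> H x t)) = (\<lambda>(x, t). h x t)"
      by (auto simp: h_def indicator_def fun_eq_iff)
    finally show ?thesis by (simp add: borel_prod)
  qed
  note measurable_compose[OF measurable_Pair hm, simplified, measurable]
  have H: "0 \<le> H y t" "integrable lborel (\<lambda>y. H y t)" "(LINT y|lborel. H y t) \<le> 1" if "0 < t" for t y
    using assms(6) that unfolding is_heat_kernel_def by auto
  have h0: "0 \<le> h x t" for x t by (simp add: h_def indicator_def H)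
  obtain K where K: "0 \<le> K" "\<And>t d x. 0 < t \<Longrightarrow> 0 < d \<Longrightarrow>
      (LINT y|lborel. H y t * exp (- ((x - y) \<bullet> (x - y)) / (2 * d\<^sup>2))) \<le> K * t powr - S * d ^ CARD('n)"
    using heat_kernel_gaussian_average[OF assms(5,2,3,6)] unfolding S_def by blast
  define Q where "Q = K * (1 / sqrt (2 * pi)) ^ CARD('n)"
  have Q: "0 \<le> Q" using K by (simp add: Q_def)
  have sup: "AE y in lborel. H y t \<le> Q * t powr - S" if t: "0 < t" for t
    using AE_le_of_gaussian_averages[OF H(1,2)[OF t], of "K * t powr - S"] K t
    by (simp add: Q_def mult_ac)
  have Hp: "(\<integral>\<^sup>+ x. ennreal (H x t powr p) \<partial>lborel) \<le> ennreal (Q powr (p - 1) * t powr - (1 / 2))" if t: "0 < t" for t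
  proof -
    have "(\<integral>\<^sup>+ x. ennreal (H x t powr p) \<partial>lborel) \<le> (\<integral>\<^sup>+ x. ennreal ((Q * t powr - S) powr (p - 1)) * ennreal (H x t) \<partial>lborel)"
    proof (rule nn_integral_mono_AE, use sup[OF t] in eventually_elim)
      case (elim x)
      have "H x t powr p = H x t powr (p - 1) * H x t"
        using H(1)[OF t, of x] by (cases "H x t = 0") (auto simp: powr_diff)
      also have "\<dots> \<le> (Q * t powr - S) powr (p - 1) * H x t"
        using H(1)[OF t] elim p by (intro mult_right_mono powr_mono2) auto
      finally show ?case using H(1)[OF t] by (simp add: ennreal_leI flip: ennreal_mult)
    qed
    also have "\<dots> = ennreal ((Q * t powr - S) powr (p - 1)) * (\<integral>\<^sup>+ x. ennreal (H x t) \<partial>lborel)"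
      using borel_measurable_integrable[OF H(2)[OF t]] by (intro nn_integral_cmult) auto
    also have "(\<integral>\<^sup>+ x. ennreal (H x t) \<partial>lborel) = ennreal (LINT x|lborel. H x t)"
      using H[OF t] by (intro nn_integral_eq_integral) auto
    also have "ennreal ((Q * t powr - S) powr (p - 1)) * ennreal (LINT x|lborel. H x t)
       \<le> ennreal ((Q * t powr - S) powr (p - 1)) * ennreal 1"
      by (intro mult_left_mono ennreal_leI H t) auto
    also have "(Q * t powr - S) powr (p - 1) = Q powr (p - 1) * t powr - (1 / 2)"
      using Q t by (simp add: powr_mult powr_powr pS)
    finally show ?thesis by simp
  qed
  define G where "G x = (\<integral>\<^sup>+ t. ennreal (indicator {0<..} t * exp (- t) * h x t) \<partial>lborel)" for x
  have green: "resolvent_green H x0 x = G (x - x0)" for x0 x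
    unfolding resolvent_green_def G_def h_def by (intro nn_integral_cong) (auto simp: indicator_def)
  have Gm [measurable]: "G \<in> borel_measurable borel" unfolding G_def by measurable
  have norm: "Lp_norm p (resolvent_green H x0) = ennreal_powr (\<integral>\<^sup>+ x. ennreal_powr (G x) p \<partial>lborel) (1 / p)" for x0
    unfolding Lp_norm_def green by (subst nn_integral_lborel_translate) auto
  have "(\<integral>\<^sup>+ x. ennreal_powr (G x) p \<partial>lborel)
     \<le> (\<integral>\<^sup>+ x. \<integral>\<^sup>+ t. ennreal (indicator {0<..} t * exp (- t) * h x t powr p) \<partial>lborel \<partial>lborel)"
    unfolding G_def by (intro nn_integral_mono exp_weighted_jensen p h0) measurable
  also have "\<dots> = (\<integral>\<^sup>+ t. \<integral>\<^sup>+ x. ennreal (indicator {0<..} t * exp (- t) * h x t powr p) \<partial>lborel \<partial>lborel)"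
    by (rule lborel_pair.Fubini'[symmetric]) measurable
  also have "\<dots> \<le> (\<integral>\<^sup>+ t. ennreal (Q powr (p - 1)) * ennreal (indicator {0..} t * t powr (1 / 2 - 1) / exp t) \<partial>lborel)"
  proof (rule nn_integral_mono)
    fix t :: real
    show "(\<integral>\<^sup>+ x. ennreal (indicator {0<..} t * exp (- t) * h x t powr p) \<partial>lborel)
      \<le> ennreal (Q powr (p - 1)) * ennreal (indicator {0..} t * t powr (1 / 2 - 1) / exp t)"
    proof (cases "0 < t")
      case True
      then have "(\<integral>\<^sup>+ x. ennreal (indicator {0<..} t * exp (- t) * h x t powr p) \<partial>lborel)
         = (\<integral>\<^sup>+ x. ennreal (exp (- t)) * ennreal (H x t powr p) \<partial>lborel)"
        by (simp add: h_def ennreal_mult)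
      also have "\<dots> = ennreal (exp (- t)) * (\<integral>\<^sup>+ x. ennreal (H x t powr p) \<partial>lborel)"
        using borel_measurable_integrable[OF H(2)[OF True]] by (intro nn_integral_cmult) auto
      also have "\<dots> \<le> ennreal (exp (- t)) * ennreal (Q powr (p - 1) * t powr - (1 / 2))"
        by (intro mult_left_mono Hp True) auto
      also have "\<dots> = ennreal (Q powr (p - 1)) * ennreal (indicator {0..} t * t powr (1 / 2 - 1) / exp t)"
      proof -
        have "exp (- t) * (Q powr (p - 1) * t powr - (1 / 2)) = Q powr (p - 1) * (indicator {0..} t * t powr (1 / 2 - 1) / exp t)"
          using True by (simp add: exp_minus field_simps)
        then show ?thesis by (subst (1 2) ennreal_mult[symmetric]) auto
      qed
      finally show ?thesis .
    qed (simp add: h_def)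
  qed
  also have "\<dots> = ennreal (Q powr (p - 1)) * ennreal (Gamma (1 / 2))"
    by (subst nn_integral_cmult) (auto simp: Gamma_conv_nn_integral_real)
  also have "\<dots> < \<top>" by (simp add: ennreal_mult_less_top)
  finally have "(\<integral>\<^sup>+ x. ennreal_powr (G x) p \<partial>lborel) \<noteq> \<top>" by simp
  then have "Lp_norm p (resolvent_green H 0)
      \<le> ennreal (enn2real (\<integral>\<^sup>+ x. ennreal_powr (G x) p \<partial>lborel) powr (1 / p))"
    unfolding norm by (simp add: ennreal_powr_def)
  then show ?thesis
    using p norm unfolding S_def[symmetric] by (intro bexI[of _ p] exI allI conjI) auto
qed

end
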